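(* Let $m\ge 1$ be an integer, let $a_0,\dots,a_m\in C^\infty([0,1])$ be real-valued, and let $S(x,t)=\sum_{i=0}^m a_i(t)x^i$. Let $a,b$ be two smooth real functions on $[0,1]$ with $a(0)=a(1)$, $b(0)=b(1)$ and $a(t)>0$ for all $t\in[0,1]$. For $\lambda\in\mathbb R$ let $\gamma_\lambda$ be the curve $t\mapsto (t,\lambda a(t)+b(t))$, $t\in[0,1]$, and let $v_S=(1,S(x,t))$ be the vector field induced by the equation $\dot x=S(x,t)$. Assume that there exist $m$ real numbers $\lambda_1<\cdots<\lambda_m$ such that either $$(-1)^i\det\big(\dot\gamma_{\lambda_i},v_S\big)\big|_{\gamma_{\lambda_i}}\ge 0\quad\text{on }[0,1]\text{ for all } i=1,\dots,m,$$ or $$(-1)^i\det\big(\dot\gamma_{\lambda_i},v_S\big)\big|_{\gamma_{\lambda_i}}\le 0\quad\text{on }[0,1]\text{ for all } i=1,\dots,m.$$ Then the equation $\dot x=S(x,t)$ has at most $m$ non-zero isolated periodic solutions, counted with multiplicities. This upper bound is sharp, i.e. for every $m\ge1$ there are data $S,a,b,\lambda_1,\dots,\lambda_m$ satisfying the assumptions for which the equation has exactly $m$ non-zero isolated periodic solutions, counted with multiplicities.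
   Context: The equation is $\dot x=\frac{dx}{dt}=S(x,t)$ with $x\in\mathbb R$, $t\in[0,1]$. The dot denotes the derivative in $t$, so $\dot\gamma_\lambda(t)=(1,\lambda\dot a(t)+\dot b(t))$; $\det(\cdot,\cdot)$ is the determinant of two $2$-dimensional vectors, and $|_{\gamma_\lambda}$ means evaluation along the curve, so that $\det(\dot\gamma_\lambda,v_S)|_{\gamma_\lambda}=S(\lambda a(t)+b(t),t)-\lambda\dot a(t)-\dot b(t)$ as a function of $t\in[0,1]$. A solution $x(t)$ is called a periodic solution if it is defined on all of $[0,1]$ and $x(0)=x(1)$; it is non-zero if it is not the solution $x(t)\equiv0$. Let $x(t,x_0)$ denote the solution with $x(0,x_0)=x_0$, and let $H(x_0)=x(1,x_0)$ be the return map, defined for those $x_0$ whose solution exists on $[0,1]$. A periodic solution $x(t,x_0)$ is isolated if $x_0$ is an isolated zero of $H(\cdot)-\mathrm{id}$, and its multiplicity is the order of that zero. *)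

theory Defs
  imports "HOL-Analysis.Analysis"
begin

(* Functions on [0,1] are total functions on the reals; only their values on {0..1} matter,
   and derivatives are taken within {0..1}, hence one-sided at the endpoints. *)

definition smooth_unit :: "(real \<Rightarrow> real) \<Rightarrow> bool" where
  "smooth_unit f \<longleftrightarrow>
    (\<exists>D :: nat \<Rightarrow> real \<Rightarrow> real. (\<forall>t\<in>{0..1}. D 0 t = f t) \<and>
      (\<forall>k. \<forall>t\<in>{0..1}. (D k has_real_derivative D (Suc k) t) (at t within {0..1})))"

definition poly_rhs :: "nat \<Rightarrow> (nat \<Rightarrow> real \<Rightarrow> real) \<Rightarrow> real \<Rightarrow> real \<Rightarrow> real" where
  "poly_rhs m c x t = (\<Sum>i\<le>m. c i t * x ^ i)"

definition solves :: "(real \<Rightarrow> real \<Rightarrow> real) \<Rightarrow> (real \<Rightarrow> real) \<Rightarrow> bool" where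
  "solves S x \<longleftrightarrow>
    (\<forall>t\<in>{0..1}. (x has_real_derivative S (x t) t) (at t within {0..1}))"

definition return_dom :: "(real \<Rightarrow> real \<Rightarrow> real) \<Rightarrow> real set" where
  "return_dom S = {x0. \<exists>x. solves S x \<and> x 0 = x0}"

(* Meaningful on return_dom S only, provided that initial value problems for S are uniquely
   solvable, as they are for poly_rhs with continuous coefficients. *)
definition return_map :: "(real \<Rightarrow> real \<Rightarrow> real) \<Rightarrow> real \<Rightarrow> real" where
  "return_map S x0 = (THE y. \<exists>x. solves S x \<and> x 0 = x0 \<and> x 1 = y)"

(* A periodic solution is identified with its initial value. *)
definition periodic_inits :: "(real \<Rightarrow> real \<Rightarrow> real) \<Rightarrow> real set" where
  "periodic_inits S = {x0 \<in> return_dom S. return_map S x0 = x0}"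

(* The solution x = 0 is excluded only if it is a solution: the initial value 0 counts as
   non-zero when the solution starting there is not identically 0. *)
definition nonzero_isolated_inits :: "(real \<Rightarrow> real \<Rightarrow> real) \<Rightarrow> real set" where
  "nonzero_isolated_inits S =
    {x0. x0 isolated_in periodic_inits S \<and>
      (\<exists>x. solves S x \<and> x 0 = x0 \<and> (\<exists>t\<in>{0..1}. x t \<noteq> 0))}"

(* The least order of a non-vanishing derivative of f at x0; infinite if all derivatives vanish. *)
definition zero_order :: "(real \<Rightarrow> real) \<Rightarrow> real \<Rightarrow> enat" where
  "zero_order f x0 = (INF k\<in>{k. (deriv ^^ k) f x0 \<noteq> 0}. enat k)"

definition periodic_mult :: "(real \<Rightarrow> real \<Rightarrow> real) \<Rightarrow> real \<Rightarrow> enat" where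
  "periodic_mult S x0 = zero_order (\<lambda>y. return_map S y - y) x0"

(* The case distinction is needed because a sum over an infinite set is 0. *)
definition count_nonzero_isolated :: "(real \<Rightarrow> real \<Rightarrow> real) \<Rightarrow> enat" where
  "count_nonzero_isolated S =
    (if finite (nonzero_isolated_inits S)
     then \<Sum>x0\<in>nonzero_isolated_inits S. periodic_mult S x0 else \<infinity>)"

(* Points and vectors of the plane have coordinates (t, x). *)

definition curve :: "(real \<Rightarrow> real) \<Rightarrow> (real \<Rightarrow> real) \<Rightarrow> real \<Rightarrow> real \<Rightarrow> real^2" where
  "curve a b l t = vector [t, l * a t + b t]"

definition induced_field :: "(real \<Rightarrow> real \<Rightarrow> real) \<Rightarrow> real^2 \<Rightarrow> real^2" where
  "induced_field S p = vector [1, S (p $ 2) (p $ 1)]"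

definition det_along :: "(real \<Rightarrow> real \<Rightarrow> real) \<Rightarrow> (real \<Rightarrow> real^2) \<Rightarrow> real \<Rightarrow> real" where
  "det_along S g t =
    det (vector [vector_derivative g (at t within {0..1}), induced_field S (g t)] :: real^2^2)"

lemma det_along_curve:
  assumes a: "(a has_real_derivative a') (at t within {0..1})"
    and b: "(b has_real_derivative b') (at t within {0..1})"
    and t: "t \<in> {0..1}"
  shows "det_along S (curve a b l) t = S (l * a t + b t) t - l * a' - b'"
proof -
  have "(curve a b l has_vector_derivative vector [1, l * a' + b']) (at t within {0..1})"
    unfolding has_vector_derivative_def
  proof (subst has_derivative_componentwise_within, rule ballI)
    fix e :: "real^2" assume "e \<in> Basis"
    then consider "e = axis 1 1" | "e = axis 2 1"
      by (auto simp: Basis_vec_def exhaust_2) (metis exhaust_2)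
    then show "((\<lambda>s. curve a b l s \<bullet> e) has_derivative
        (\<lambda>s. (s *\<^sub>R vector [1, l * a' + b'] :: real^2) \<bullet> e)) (at t within {0..1})"
    proof cases
      case 1
      then show ?thesis
        by (simp add: curve_def inner_axis)
    next
      case 2
      have "((\<lambda>s. l * a s + b s) has_real_derivative l * a' + b') (at t within {0..1})"
        using a b by (auto intro!: derivative_eq_intros)
      with 2 show ?thesis
        by (simp add: curve_def inner_axis has_real_derivative_iff_has_vector_derivative
            has_vector_derivative_def)
    qed
  qed
  then have "vector_derivative (curve a b l) (at t within {0..1}) = vector [1, l * a' + b']"
    using t by (simp add: vector_derivative_within_closed_interval[of 0 1])
  then show ?thesis
    by (simp add: det_along_def det_2 induced_field_def curve_def)
qed

(* l 1 < ... < l m are the parameters of the m curves; l is irrelevant outside {1..m}. *)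
definition admissible ::
  "nat \<Rightarrow> (nat \<Rightarrow> real \<Rightarrow> real) \<Rightarrow> (real \<Rightarrow> real) \<Rightarrow> (real \<Rightarrow> real) \<Rightarrow> (nat \<Rightarrow> real) \<Rightarrow> bool" where
  "admissible m c a b l \<longleftrightarrow>
    (\<forall>i\<le>m. smooth_unit (c i)) \<and> smooth_unit a \<and> smooth_unit b \<and>
    a 0 = a 1 \<and> b 0 = b 1 \<and> (\<forall>t\<in>{0..1}. a t > 0) \<and>
    strict_mono_on {1..m} l \<and>
    ((\<forall>i\<in>{1..m}. \<forall>t\<in>{0..1}. (-1) ^ i * det_along (poly_rhs m c) (curve a b (l i)) t \<ge> 0) \<or>
     (\<forall>i\<in>{1..m}. \<forall>t\<in>{0..1}. (-1) ^ i * det_along (poly_rhs m c) (curve a b (l i)) t \<le> 0))"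

end

theory Submission
  imports Defs
begin

text \<open>The substitution \<open>x = a(t) y + b(t)\<close> turns the equation into \<open>y' = R(y,t)\<close> with \<open>R\<close> of degree at
  most \<open>m\<close> in \<open>y\<close>, and the curves into the lines \<open>y = \<lambda>\<^sub>i\<close>. With \<open>W(y) = \<Prod> (y - \<lambda>\<^sub>i)\<close>, Lagrange
  interpolation gives \<open>R = W F\<close>, \<open>F(y,t) = p(t) + \<Sum> q\<^sub>i(t) / (y - \<lambda>\<^sub>i)\<close>, and the alternating signs of
  \<open>R(\<lambda>\<^sub>i,t)\<close> mean that all the \<open>q\<^sub>i\<close> have one and the same sign, so that \<open>F\<close> is monotone in \<open>y\<close> between
  its poles. Let \<open>K\<close> be the set of the \<open>\<lambda>\<^sub>i\<close> with \<open>q\<^sub>i\<close> not identically zero. Periodic solutions do not meet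
  \<open>K\<close>; the other \<open>\<lambda>\<^sub>i\<close> are themselves periodic solutions. A periodic solution \<open>y\<close> that is not one of the
  \<open>\<lambda>\<^sub>i\<close> satisfies \<open>\<integral> F(y(t),t) dt = \<integral> dy / W(y) = 0\<close>, and a periodic \<open>\<lambda>\<^sub>i\<close> is a multiple one exactly if
  it satisfies this equation, in which case it is double. By monotonicity every component of the
  complement of \<open>K\<close> contains at most one solution of the equation, and the two unbounded components
  cannot both contain one, as they require opposite signs of \<open>\<integral> p\<close>. Hence there are at most \<open>card K\<close>
  such solutions, and \<open>m - card K + card K = m\<close> is the bound. If \<open>K\<close> is empty and \<open>\<integral> p = 0\<close>, then
  all solutions are periodic and none is isolated.\<close>

section \<open>Existence of solutions near a given one\<close>

lemma abs_integral_upto_le: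
  fixes f :: "real \<Rightarrow> real"
  assumes "continuous_on {0..1} f" "\<And>s. s \<in> {0..1} \<Longrightarrow> \<bar>f s\<bar> \<le> B" "t \<in> {0..1}"
  shows "\<bar>integral {0..t} f\<bar> \<le> B"
proof -
  have B: "B \<ge> 0" using assms(2)[of 0] by (force intro: order_trans[OF abs_ge_zero])
  have "\<bar>integral {0..t} f\<bar> \<le> B * (t - 0)"
    using assms by (intro integral_bound[of 0 t f B, simplified real_norm_def])
      (auto intro: continuous_on_subset)
  also have "\<dots> \<le> B" using assms(3) B by (simp add: mult_left_le)
  finally show ?thesis .
qed

text \<open>From \<open>1 + z \<le> exp z\<close>, which bounds the slope of a chord by the slope at
  its right end. It yields the contraction estimate in the next lemma.\<close>

lemma abs_exp_diff_le:
  fixes x y :: real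
  assumes "x \<le> M" "y \<le> M"
  shows "\<bar>exp x - exp y\<bar> \<le> exp M * \<bar>x - y\<bar>"
proof -
  have *: "exp x - exp y \<le> exp M * (x - y)" if "y \<le> x" "x \<le> M" for x y :: real
  proof -
    have "exp y \<ge> exp x * (1 + (y - x))"
      using mult_left_mono[OF exp_ge_add_one_self[of "y - x"], of "exp x"]
      by (simp flip: exp_add)
    then have "exp x - exp y \<le> exp x * (x - y)" by (simp add: algebra_simps)
    also have "\<dots> \<le> exp M * (x - y)" using that by (intro mult_right_mono) auto
    finally show ?thesis .
  qed
  show ?thesis
    using *[of y x] *[of x y] assms by (cases "y \<le> x") (auto simp: abs_if)
qed

text \<open>The equation \<open>u' = g(u,t) u\<close> with \<open>u(0) = e\<close> is the fixed point equation
  \<open>u = e exp (\<integral> g(u))\<close>, whose right-hand side is a contraction of the unit ball as soon as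
  \<open>e\<close> is small.\<close>

lemma small_solution_exists:
  fixes g :: "real \<Rightarrow> real \<Rightarrow> real"
  assumes cont: "continuous_on ({-1..1} \<times> {0..1}) (\<lambda>(u, t). g u t)"
    and lip: "\<And>u v t. \<bar>u\<bar> \<le> 1 \<Longrightarrow> \<bar>v\<bar> \<le> 1 \<Longrightarrow> t \<in> {0..1} \<Longrightarrow> \<bar>g u t - g v t\<bar> \<le> L * \<bar>u - v\<bar>"
  obtains d C :: real where "d > 0"
    "\<And>e. \<bar>e\<bar> < d \<Longrightarrow> \<exists>u. u 0 = e \<and> (\<forall>t\<in>{0..1}. \<bar>u t\<bar> \<le> C * \<bar>e\<bar> \<and>
        (u has_real_derivative g (u t) t * u t) (at t within {0..1}))"
proof -
  have "compact ((\<lambda>(u, t). g u t) ` ({-1..1} \<times> {0..1}))"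
    by (intro compact_continuous_image cont compact_Times) auto
  then have "bounded ((\<lambda>(u, t). g u t) ` ({-1..1} \<times> {0..1}))"
    by (rule compact_imp_bounded)
  then obtain M where M0: "\<And>z. z \<in> {-1..1} \<times> {0..1} \<Longrightarrow> \<bar>(\<lambda>(u, t). g u t) z\<bar> \<le> M"
    unfolding bounded_iff by auto
  have M: "\<bar>g u t\<bar> \<le> M" if "\<bar>u\<bar> \<le> 1" "t \<in> {0..1}" for u t
    using M0[of "(u, t)"] that by (auto simp: abs_le_iff minus_le_iff)
  have L: "L \<ge> 0" using lip[of 1 0 0] by (auto intro: order_trans[OF abs_ge_zero])
  \<comment> \<open>Small enough for two purposes: \<open>\<bar>e\<bar> * exp M \<le> 1\<close>
    keeps the fixed point map inside the unit ball, and
    \<open>\<bar>e\<bar> * exp M * L \<le> 1/2\<close> makes it a contraction.\<close>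
  define d where "d = inverse (2 * exp M * (1 + L))"
  have d: "d > 0" using L by (simp add: d_def)
  have main: "\<exists>u. u 0 = e \<and> (\<forall>t\<in>{0..1}. \<bar>u t\<bar> \<le> exp M * \<bar>e\<bar> \<and>
        (u has_real_derivative g (u t) t * u t) (at t within {0..1}))" if e: "\<bar>e\<bar> < d" for e
  proof -
    have eM: "\<bar>e\<bar> * exp M * (1 + L) \<le> 1/2"
    proof -
      have "\<bar>e\<bar> * (exp M * (1 + L)) \<le> d * (exp M * (1 + L))"
        using e L by (intro mult_right_mono) auto
      also have "\<dots> = 1/2" using L by (simp add: d_def inverse_eq_divide)
      finally show ?thesis by (simp add: mult.assoc)
    qed
    have eM1: "\<bar>e\<bar> * exp M \<le> 1" and eML: "\<bar>e\<bar> * exp M * L \<le> 1/2"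
    proof -
      have "0 \<le> \<bar>e\<bar> * exp M" "0 \<le> \<bar>e\<bar> * exp M * L" using L by auto
      moreover have "\<bar>e\<bar> * exp M * (1 + L) = \<bar>e\<bar> * exp M + \<bar>e\<bar> * exp M * L"
        by (simp add: algebra_simps)
      ultimately show "\<bar>e\<bar> * exp M \<le> 1" "\<bar>e\<bar> * exp M * L \<le> 1/2" using eM by linarith+
    qed
    \<comment> \<open>The space of bounded continuous functions used here consists of functions on
      the whole line, so time is clamped to [0,1].\<close>
    define k where "k t = max 0 (min 1 t)" for t :: real
    have k: "k t \<in> {0..1}" for t by (auto simp: k_def)
    have kid: "k t = t" if "t \<in> {0..1}" for t using that by (auto simp: k_def)
    have kcont: "continuous_on A k" for A unfolding k_def by (intro continuous_intros)
    define B where "B = cball (0 :: real \<Rightarrow>\<^sub>C real) 1"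
    have Bb: "\<bar>apply_bcontfun u s\<bar> \<le> 1" if "u \<in> B" for u s
      using norm_bounded[of u s] that by (auto simp: B_def)
    have gc: "continuous_on {0..1} (\<lambda>s. g (apply_bcontfun u s) s)" if "u \<in> B" for u
    proof -
      have "continuous_on {0..1} (\<lambda>s. (\<lambda>(u, t). g u t) (apply_bcontfun u s, s))"
        using Bb[OF that] by (intro continuous_on_compose2[OF cont] continuous_intros)
          (auto simp: abs_le_iff minus_le_iff)
      then show ?thesis by simp
    qed
    define J where "J u t = integral {0..k t} (\<lambda>s. g (apply_bcontfun u s) s)" for u t
    have J: "\<bar>J u t\<bar> \<le> M" if "u \<in> B" for u t
      unfolding J_def using Bb[OF that] M k by (intro abs_integral_upto_le gc that) auto
    have Jle: "\<bar>e\<bar> * exp (J u t) \<le> \<bar>e\<bar> * exp M" if "u \<in> B" for u t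
      using J[OF that, of t] by (intro mult_left_mono) auto
    define T where "T u = Bcontfun (\<lambda>t. e * exp (J u t))" for u
    have T: "apply_bcontfun (T u) t = e * exp (J u t)" if "u \<in> B" for u t
    proof -
      have "continuous_on {0..1} (\<lambda>t. integral {0..t} (\<lambda>s. g (apply_bcontfun u s) s))"
        by (intro indefinite_integral_continuous_1 integrable_continuous_real gc that)
      then have "continuous_on UNIV (J u)"
        unfolding J_def by (rule continuous_on_compose2[OF _ kcont]) (use k in auto)
      then have "(\<lambda>t. e * exp (J u t)) \<in> bcontfun"
        using Jle[OF that]
        by (intro bcontfun_normI[where b = "\<bar>e\<bar> * exp M"] continuous_intros) (auto simp: abs_mult)
      then show ?thesis by (simp add: T_def Bcontfun_inverse)
    qed
    have "\<exists>!u\<in>B. T u = u"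
    proof (rule Banach_fix)
      show "complete B" by (simp add: B_def complete_eq_closed)
      show "B \<noteq> {}" by (simp add: B_def)
      show "(0::real) \<le> 1/2" "(1/2::real) < 1" by auto
      show "T ` B \<subseteq> B"
      proof safe
        fix u assume u: "u \<in> B"
        have "norm (T u) \<le> 1"
          using Jle[OF u] eM1 by (intro norm_bound) (auto simp: T[OF u] abs_mult intro: order_trans)
        then show "T u \<in> B" by (simp add: B_def)
      qed
      show "dist (T u) (T v) \<le> 1/2 * dist u v" if "u \<in> B" "v \<in> B" for u v
      proof (rule dist_bound)
        fix t
        have uv: "\<bar>apply_bcontfun u s - apply_bcontfun v s\<bar> \<le> dist u v" for s
          using dist_bounded[of u s v] by (simp add: dist_real_def)
        have "J u t - J v t = integral {0..k t} (\<lambda>s. g (apply_bcontfun u s) s - g (apply_bcontfun v s) s)"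
          unfolding J_def using k[of t] that
          by (intro integral_diff[symmetric] integrable_continuous_real
               continuous_on_subset[OF gc]) auto
        also have "\<bar>\<dots>\<bar> \<le> L * dist u v"
        proof (rule abs_integral_upto_le)
          show "continuous_on {0..1} (\<lambda>s. g (apply_bcontfun u s) s - g (apply_bcontfun v s) s)"
            by (intro continuous_intros gc that)
          show "\<bar>g (apply_bcontfun u s) s - g (apply_bcontfun v s) s\<bar> \<le> L * dist u v"
            if "s \<in> {0..1}" for s
            using lip[OF Bb[OF \<open>u \<in> B\<close>, of s] Bb[OF \<open>v \<in> B\<close>, of s] that]
              mult_left_mono[OF uv[of s] L] by linarith
        qed (use k in auto)
        finally have D: "\<bar>J u t - J v t\<bar> \<le> L * dist u v" .
        have "dist (T u t) (T v t) = \<bar>e\<bar> * \<bar>exp (J u t) - exp (J v t)\<bar>"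
          by (simp add: T that dist_real_def flip: abs_mult right_diff_distrib)
        also have "\<dots> \<le> \<bar>e\<bar> * (exp M * (L * dist u v))"
          using J[OF that(1), of t] J[OF that(2), of t] D
          by (intro mult_left_mono order_trans[OF abs_exp_diff_le[of _ M]]) auto
        also have "\<dots> = (\<bar>e\<bar> * exp M * L) * dist u v" by simp
        also have "\<dots> \<le> 1/2 * dist u v" using eML by (intro mult_right_mono) auto
        finally show "dist (T u t) (T v t) \<le> 1/2 * dist u v" .
      qed
    qed
    then obtain u where u: "u \<in> B" "T u = u" by auto
    have ueq: "apply_bcontfun u t = e * exp (J u t)" for t using T[OF u(1), of t] u(2) by simp
    show ?thesis
    proof (intro exI[of _ "apply_bcontfun u"] conjI ballI)
      show "apply_bcontfun u 0 = e" by (subst ueq) (simp add: J_def k_def)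
      fix t :: real assume t: "t \<in> {0..1}"
      show "\<bar>apply_bcontfun u t\<bar> \<le> exp M * \<bar>e\<bar>"
        using Jle[OF u(1), of t] by (subst ueq) (simp add: abs_mult mult.commute)
      have ut: "apply_bcontfun u t = e * exp (integral {0..t} (\<lambda>s. g (apply_bcontfun u s) s))" if "t \<in> {0..1}" for t
        using ueq[of t] that by (simp add: J_def kid)
      have "((\<lambda>t. e * exp (integral {0..t} (\<lambda>s. g (apply_bcontfun u s) s)))
          has_real_derivative g (u t) t * (e * exp (integral {0..t} (\<lambda>s. g (apply_bcontfun u s) s))))
          (at t within {0..1})"
        using integral_has_real_derivative[OF gc[OF u(1)] t]
        by (auto intro!: derivative_eq_intros)
      then have "((\<lambda>t. e * exp (integral {0..t} (\<lambda>s. g (apply_bcontfun u s) s)))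
          has_real_derivative g (u t) t * u t) (at t within {0..1})"
        by (simp only: flip: ut[OF t])
      then show "(apply_bcontfun u has_real_derivative g (u t) t * u t) (at t within {0..1})"
        by (rule has_field_derivative_transform_within[OF _ zero_less_one t]) (simp add: ut)
    qed
  qed
  show ?thesis by (rule that[OF d]) (rule main)
qed

section \<open>The return map of a polynomial equation and its derivatives\<close>

text \<open>The divided difference in the space variable with the division carried out: it is
  polynomial and stays continuous on the diagonal, where it becomes the derivative.\<close>

definition poly_rhs_dd :: "nat \<Rightarrow> (nat \<Rightarrow> real \<Rightarrow> real) \<Rightarrow> real \<Rightarrow> real \<Rightarrow> real \<Rightarrow> real" where
  "poly_rhs_dd m c x y t = (\<Sum>i\<le>m. c i t * (\<Sum>j<i. y ^ (i - Suc j) * x ^ j))"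

definition poly_rhs_dx :: "nat \<Rightarrow> (nat \<Rightarrow> real \<Rightarrow> real) \<Rightarrow> real \<Rightarrow> real \<Rightarrow> real" where
  "poly_rhs_dx m c x t = (\<Sum>i\<le>m. c i t * (real i * x ^ (i - 1)))"

text \<open>Truncated subtraction does no harm: where an exponent is cut off at 0, one of the
  factors \<open>real i\<close> and \<open>real (i - 1)\<close> vanishes.\<close>

definition poly_rhs_dxx :: "nat \<Rightarrow> (nat \<Rightarrow> real \<Rightarrow> real) \<Rightarrow> real \<Rightarrow> real \<Rightarrow> real" where
  "poly_rhs_dxx m c x t = (\<Sum>i\<le>m. c i t * (real i * (real (i - 1) * x ^ (i - 2))))"

lemma poly_rhs_diff: "poly_rhs m c x t - poly_rhs m c y t = poly_rhs_dd m c x y t * (x - y)"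
  unfolding poly_rhs_def poly_rhs_dd_def sum_subtractf[symmetric] sum_distrib_right
  by (intro sum.cong refl, subst right_diff_distrib[symmetric]) (simp add: power_diff_sumr2 mult_ac)

lemma poly_rhs_dd_same: "poly_rhs_dd m c x x t = poly_rhs_dx m c x t"
proof -
  have "(\<Sum>j<i. x ^ (i - Suc j) * x ^ j) = real i * x ^ (i - 1)" for i
  proof -
    have "(\<Sum>j<i. x ^ (i - Suc j) * x ^ j) = (\<Sum>j<i. x ^ (i - 1))"
      by (intro sum.cong refl) (simp flip: power_add)
    then show ?thesis by simp
  qed
  then show ?thesis by (simp add: poly_rhs_dd_def poly_rhs_dx_def)
qed

lemma DERIV_poly_rhs: "((\<lambda>x. poly_rhs m c x t) has_real_derivative poly_rhs_dx m c x t) (at x)"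
  unfolding poly_rhs_def poly_rhs_dx_def
  by (auto intro!: derivative_eq_intros sum.cong)

lemma DERIV_poly_rhs_dx:
  "((\<lambda>x. poly_rhs_dx m c x t) has_real_derivative poly_rhs_dxx m c x t) (at x)"
  unfolding poly_rhs_dx_def poly_rhs_dxx_def
  by (auto intro!: derivative_eq_intros sum.cong simp: numeral_2_eq_2)

text \<open>Rescaling \<open>[0,t]\<close> to \<open>[0,1]\<close> turns the moving upper limit into
  a parameter of the integrand, so that continuity of parameter integrals over a fixed interval
  applies.\<close>

lemma integral_upto_continuous:
  fixes f :: "'a::metric_space \<Rightarrow> real \<Rightarrow> real"
  assumes "continuous_on (U \<times> {0..1}) (\<lambda>(x, t). f x t)"
  shows "continuous_on (U \<times> {0..1}) (\<lambda>(x, t). integral {0..t} (f x))"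
proof -
  have fx: "continuous_on {0..1} (f x)" if "x \<in> U" for x
  proof -
    have "continuous_on {0..1} (\<lambda>t. (\<lambda>(x, t). f x t) (x, t))"
      by (rule continuous_on_compose2[OF assms]) (use that in \<open>auto intro!: continuous_intros\<close>)
    then show ?thesis by simp
  qed
  have eq: "integral {0..t} (f x) = t * integral {0..1} (\<lambda>s. f x (t * s))"
    if x: "x \<in> U" and t: "t \<in> {0..1}" for x t
  proof -
    have "((\<lambda>s. f x (t * s) * t) has_integral
       integral {0..t * 1} (f x) - integral {0..t * 0} (f x)) {0..1}"
    proof (rule fundamental_theorem_of_calculus)
      fix s :: real assume s: "s \<in> {0..1}"
      have ts: "t * s \<in> {0..1}" "(*) t ` {0..1} \<subseteq> {0..1}"
        using s t by (auto intro: mult_le_one)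
      have "((\<lambda>u. integral {0..u} (f x)) has_real_derivative f x (t * s)) (at (t * s) within (*) t ` {0..1})"
        using integral_has_real_derivative[OF fx[OF x] ts(1)] ts(2)
        by (rule has_field_derivative_subset)
      moreover have "((*) t has_real_derivative t) (at s within {0..1})"
        by (auto intro!: derivative_eq_intros)
      ultimately have "((\<lambda>u. integral {0..u} (f x)) \<circ> (*) t has_real_derivative f x (t * s) * t)
          (at s within {0..1})"
        by (rule DERIV_image_chain)
      then show "((\<lambda>s. integral {0..t * s} (f x)) has_vector_derivative f x (t * s) * t)
          (at s within {0..1})"
        by (simp add: o_def has_real_derivative_iff_has_vector_derivative)
    qed simp
    from integral_unique[OF this] show ?thesis by (simp add: mult.commute)
  qed
  have "continuous_on ((U \<times> {0..1}) \<times> cbox 0 1)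
      (\<lambda>z. (\<lambda>(x, t). f x t) (fst (fst z), snd (fst z) * snd z))"
    by (rule continuous_on_compose2[OF assms]) (auto intro!: continuous_intros mult_le_one)
  then have "continuous_on ((U \<times> {0..1}) \<times> cbox 0 1) (\<lambda>(z, s). f (fst z) (snd z * s))"
    by (simp add: case_prod_unfold)
  then have "continuous_on (U \<times> {0..1}) (\<lambda>z. integral (cbox 0 1) (\<lambda>s. f (fst z) (snd z * s)))"
    by (rule integral_continuous_on_param)
  then have "continuous_on (U \<times> {0..1}) (\<lambda>z. snd z * integral {0..1} (\<lambda>s. f (fst z) (snd z * s)))"
    by (auto intro!: continuous_intros)
  then show ?thesis
    by (rule continuous_on_eq) (auto simp: eq)
qed

locale polynomial_equation =
  fixes m :: nat and c :: "nat \<Rightarrow> real \<Rightarrow> real"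
  assumes continuous_coeff: "i \<le> m \<Longrightarrow> continuous_on {0..1} (c i)"
begin

abbreviation "S \<equiv> poly_rhs m c"
abbreviation "S_dd \<equiv> poly_rhs_dd m c"
abbreviation "S_dx \<equiv> poly_rhs_dx m c"
abbreviation "S_dxx \<equiv> poly_rhs_dxx m c"

lemma continuous_coeff_compose [continuous_intros]:
  "i \<le> m \<Longrightarrow> continuous_on A h \<Longrightarrow> h ` A \<subseteq> {0..1} \<Longrightarrow> continuous_on A (\<lambda>z. c i (h z))"
  by (rule continuous_on_compose2[OF continuous_coeff])

lemma
  fixes f g h :: "'a::metric_space \<Rightarrow> real"
  assumes f: "continuous_on A f" and h: "continuous_on A h" "h ` A \<subseteq> {0..1}"
  shows continuous_on_S_dx [continuous_intros]: "continuous_on A (\<lambda>z. S_dx (f z) (h z))"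
    and continuous_on_S_dxx [continuous_intros]: "continuous_on A (\<lambda>z. S_dxx (f z) (h z))"
    and continuous_on_S_dd [continuous_intros]:
      "continuous_on A g \<Longrightarrow> continuous_on A (\<lambda>z. S_dd (f z) (g z) (h z))"
  unfolding poly_rhs_dd_def poly_rhs_dx_def poly_rhs_dxx_def
  using h by (auto intro!: continuous_intros f)

lemma solves_continuous: "solves S x \<Longrightarrow> continuous_on {0..1} x"
  unfolding solves_def by (intro DERIV_continuous_on) blast

text \<open>The difference of two solutions solves a linear homogeneous equation whose coefficient
  is the divided difference. Uniqueness, the ordering of solutions and the derivative of the flow
  all come from this formula.\<close>

lemma solution_diff:
  assumes x: "solves S x" and y: "solves S y" and t: "t \<in> {0..1}"
  shows "x t - y t = (x 0 - y 0) * exp (integral {0..t} (\<lambda>s. S_dd (x s) (y s) s))"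
proof -
  define I where "I t = integral {0..t} (\<lambda>s. S_dd (x s) (y s) s)" for t
  have I: "(I has_real_derivative S_dd (x t) (y t) t) (at t within {0..1})" if "t \<in> {0..1}" for t
    unfolding I_def using that solves_continuous[OF x] solves_continuous[OF y]
    by (intro integral_has_real_derivative continuous_intros) auto
  have "((\<lambda>t. (x t - y t) * exp (- I t)) has_real_derivative 0) (at t within {0..1})"
    if t: "t \<in> {0..1}" for t
  proof -
    have "((\<lambda>t. x t - y t) has_real_derivative S_dd (x t) (y t) t * (x t - y t)) (at t within {0..1})"
      using x y t unfolding solves_def poly_rhs_diff[symmetric] by (intro DERIV_diff) auto
    moreover have "((\<lambda>t. exp (- I t)) has_real_derivative - S_dd (x t) (y t) t * exp (- I t)) (at t within {0..1})"
      using I[OF t] by (auto intro!: derivative_eq_intros)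
    ultimately show ?thesis
      by (rule DERIV_cong[OF DERIV_mult]) (simp add: algebra_simps)
  qed
  then obtain k where k: "(x t - y t) * exp (- I t) = k" if "t \<in> {0..1}" for t
    using has_field_derivative_zero_constant[of "{0..1}" "\<lambda>t. (x t - y t) * exp (- I t)"] by auto
  from k[of 0] k[OF t] show ?thesis
    by (simp add: I_def exp_minus field_simps)
qed

lemma solution_unique:
  "solves S x \<Longrightarrow> solves S y \<Longrightarrow> x 0 = y 0 \<Longrightarrow> t \<in> {0..1} \<Longrightarrow> x t = y t"
  using solution_diff[of x y t] by simp

lemma return_map_eq: "solves S x \<Longrightarrow> return_map S (x 0) = x 1"
  unfolding return_map_def by (rule the_equality) (auto dest: solution_unique[where t = 1])

text \<open>Writing a neighbour as \<open>x + u\<close>, the equation for \<open>u\<close> is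
  \<open>u' = g(u,t) u\<close> with \<open>g\<close> the divided difference, which is the situation
  of \<open>small_solution_exists\<close>.\<close>

lemma solution_nearby:
  assumes x: "solves S x"
  obtains d C :: real where "d > 0"
    "\<And>e. \<bar>e\<bar> < d \<Longrightarrow> \<exists>z. solves S z \<and> z 0 = x 0 + e \<and> (\<forall>t\<in>{0..1}. \<bar>z t - x t\<bar> \<le> C * \<bar>e\<bar>)"
proof -
  define g where "g u t = S_dd (x t + u) (x t) t" for u t
  \<comment> \<open>The derivative of \<open>g\<close> in \<open>u\<close>; its bound on a compact
    set serves as Lipschitz constant.\<close>
  define g' where "g' u t = (\<Sum>i\<le>m. c i t * (\<Sum>j<i. x t ^ (i - Suc j) * (real j * (x t + u) ^ (j - 1))))" for u t
  note [continuous_intros] = continuous_on_compose2[OF solves_continuous[OF x]]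
  have g: "continuous_on ({-1..1} \<times> {0..1}) (\<lambda>(u, t). g u t)"
    unfolding g_def case_prod_unfold by (auto intro!: continuous_intros)
  have "continuous_on ({-1..1} \<times> {0..1}) (\<lambda>(u, t). g' u t)"
    unfolding g'_def case_prod_unfold by (auto intro!: continuous_intros)
  then have "compact ((\<lambda>(u, t). g' u t) ` ({-1..1} \<times> {0..1}))"
    by (intro compact_continuous_image compact_Times) auto
  then have "bounded ((\<lambda>(u, t). g' u t) ` ({-1..1} \<times> {0..1}))"
    by (rule compact_imp_bounded)
  then obtain L where L: "\<And>z. z \<in> {-1..1} \<times> {0..1} \<Longrightarrow> \<bar>(\<lambda>(u, t). g' u t) z\<bar> \<le> L"
    unfolding bounded_iff by auto
  have lip: "\<bar>g u t - g v t\<bar> \<le> L * \<bar>u - v\<bar>"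
    if "\<bar>u\<bar> \<le> 1" "\<bar>v\<bar> \<le> 1" and t: "t \<in> {0..1}" for u v t
  proof (rule field_differentiable_bound[of "{-1..1}" "\<lambda>u. g u t" "\<lambda>u. g' u t", simplified])
    show "((\<lambda>u. g u t) has_field_derivative g' w t) (at w within {-1..1})" for w
      unfolding g_def g'_def poly_rhs_dd_def
      by (auto intro!: derivative_eq_intros sum.cong)
    show "\<bar>g' w t\<bar> \<le> L" if "- 1 \<le> w \<and> w \<le> 1" for w
      using L[of "(w, t)"] that t by auto
  qed (use that in auto)
  obtain d C where d: "d > 0" and C: "\<And>e. \<bar>e\<bar> < d \<Longrightarrow> \<exists>u. u 0 = e \<and> (\<forall>t\<in>{0..1}. \<bar>u t\<bar> \<le> C * \<bar>e\<bar> \<and>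
        (u has_real_derivative g (u t) t * u t) (at t within {0..1}))"
    using small_solution_exists[OF g lip] by blast
  show ?thesis
  proof (rule that[OF d])
    fix e :: real assume "\<bar>e\<bar> < d"
    from C[OF this] obtain u where u: "u 0 = e" "\<And>t. t \<in> {0..1} \<Longrightarrow> \<bar>u t\<bar> \<le> C * \<bar>e\<bar>"
      "\<And>t. t \<in> {0..1} \<Longrightarrow> (u has_real_derivative g (u t) t * u t) (at t within {0..1})" by blast
    have "solves S (\<lambda>t. x t + u t)"
      unfolding solves_def
    proof
      fix t :: real assume t: "t \<in> {0..1}"
      have "((\<lambda>t. x t + u t) has_real_derivative S (x t) t + g (u t) t * u t) (at t within {0..1})"
        using x t unfolding solves_def by (intro DERIV_add u) auto
      moreover have "S (x t) t + g (u t) t * u t = S (x t + u t) t"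
        using poly_rhs_diff[of m c "x t + u t" t "x t"] by (simp add: g_def)
      ultimately show "((\<lambda>t. x t + u t) has_real_derivative S (x t + u t) t) (at t within {0..1})"
        by simp
    qed
    with u show "\<exists>z. solves S z \<and> z 0 = x 0 + e \<and> (\<forall>t\<in>{0..1}. \<bar>z t - x t\<bar> \<le> C * \<bar>e\<bar>)"
      by (intro exI[of _ "\<lambda>t. x t + u t"]) auto
  qed
qed

section \<open>Dependence of the flow and the return map on the initial value\<close>

definition flow :: "real \<Rightarrow> real \<Rightarrow> real" where
  "flow x0 = (SOME x. solves S x \<and> x 0 = x0)"

lemma
  assumes "x0 \<in> return_dom S"
  shows flow_solves: "solves S (flow x0)" and flow_0: "flow x0 0 = x0"
proof -
  have "\<exists>x. solves S x \<and> x 0 = x0" using assms by (simp add: return_dom_def)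
  then have "solves S (flow x0) \<and> flow x0 0 = x0" unfolding flow_def by (rule someI_ex)
  then show "solves S (flow x0)" "flow x0 0 = x0" by auto
qed

lemma return_domI: "solves S x \<Longrightarrow> x 0 \<in> return_dom S"
  by (auto simp: return_dom_def)

lemma flow_eq: "solves S x \<Longrightarrow> t \<in> {0..1} \<Longrightarrow> flow (x 0) t = x t"
  by (rule solution_unique) (simp_all add: flow_solves flow_0 return_domI)

lemma return_map_flow: "x0 \<in> return_dom S \<Longrightarrow> return_map S x0 = flow x0 1"
  using return_map_eq[OF flow_solves] flow_0 by simp

text \<open>The one estimate behind both the openness of \<open>return_dom\<close> and the joint
  continuity of the flow.\<close>

lemma flow_lipschitz:
  assumes "x0 \<in> return_dom S"
  obtains d C where "d > 0" "ball x0 d \<subseteq> return_dom S"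
    "\<And>y t. y \<in> ball x0 d \<Longrightarrow> t \<in> {0..1} \<Longrightarrow> \<bar>flow y t - flow x0 t\<bar> \<le> C * \<bar>y - x0\<bar>"
proof -
  obtain d C where d: "d > 0" and C: "\<And>e. \<bar>e\<bar> < d \<Longrightarrow>
      \<exists>z. solves S z \<and> z 0 = flow x0 0 + e \<and> (\<forall>t\<in>{0..1}. \<bar>z t - flow x0 t\<bar> \<le> C * \<bar>e\<bar>)"
    using solution_nearby[OF flow_solves[OF assms]] by blast
  have *: "y \<in> return_dom S \<and> (\<forall>t\<in>{0..1}. \<bar>flow y t - flow x0 t\<bar> \<le> C * \<bar>y - x0\<bar>)"
    if "y \<in> ball x0 d" for y
  proof -
    from C[of "y - x0"] that assms obtain z where z: "solves S z" "z 0 = y"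
      "\<And>t. t \<in> {0..1} \<Longrightarrow> \<bar>z t - flow x0 t\<bar> \<le> C * \<bar>y - x0\<bar>"
      by (auto simp: dist_real_def abs_minus_commute flow_0)
    then show ?thesis using return_domI[OF z(1)] flow_eq[OF z(1)] by auto
  qed
  show ?thesis by (rule that[OF d, of C]) (use * in auto)
qed

lemma open_return_dom: "open (return_dom S)"
  unfolding open_contains_ball
proof
  fix x0 assume "x0 \<in> return_dom S"
  then show "\<exists>e>0. ball x0 e \<subseteq> return_dom S"
    by (rule flow_lipschitz) blast
qed

lemma flow_continuous: "continuous_on (return_dom S \<times> {0..1}) (\<lambda>(x, t). flow x t)"
  unfolding continuous_on_def
proof safe
  fix x0 t0 :: real assume x0: "x0 \<in> return_dom S" and t0: "t0 \<in> {0..1}"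
  let ?F = "at (x0, t0) within return_dom S \<times> {0..1}"
  obtain d C where d: "d > 0" "ball x0 d \<subseteq> return_dom S" and
    C: "\<And>y t. y \<in> ball x0 d \<Longrightarrow> t \<in> {0..1} \<Longrightarrow> \<bar>flow y t - flow x0 t\<bar> \<le> C * \<bar>y - x0\<bar>"
    using flow_lipschitz[OF x0] by blast
  have lim: "(fst \<longlongrightarrow> x0) ?F" "(snd \<longlongrightarrow> t0) ?F"
    by (auto intro!: tendsto_eq_intros)
  \<comment> \<open>Joint continuity splits into the variation of the initial value, which is
    controlled uniformly in time, and the continuity of the single solution from
    \<open>x0\<close>.\<close>
  have "((\<lambda>z. flow (fst z) (snd z) - flow x0 (snd z)) \<longlongrightarrow> 0) ?F"
  proof (rule Lim_null_comparison)
    have "\<forall>\<^sub>F z in ?F. fst z \<in> ball x0 d"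
      using topological_tendstoD[OF lim(1), of "ball x0 d"] d by auto
    moreover have "\<forall>\<^sub>F z in ?F. z \<in> return_dom S \<times> {0..1}"
      by (simp add: eventually_at_filter)
    ultimately show "\<forall>\<^sub>F z in ?F. norm (flow (fst z) (snd z) - flow x0 (snd z)) \<le> C * \<bar>fst z - x0\<bar>"
      by eventually_elim (use C in auto)
    show "((\<lambda>z. C * \<bar>fst z - x0\<bar>) \<longlongrightarrow> 0) ?F"
      by (auto intro!: tendsto_eq_intros lim)
  qed
  moreover have "((\<lambda>z. flow x0 (snd z)) \<longlongrightarrow> flow x0 t0) ?F"
  proof -
    have "continuous_on (return_dom S \<times> {0..1}) (\<lambda>z. flow x0 (snd z))"
      by (rule continuous_on_compose2[OF solves_continuous[OF flow_solves[OF x0]]])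
        (auto intro!: continuous_intros)
    then show ?thesis using x0 t0 unfolding continuous_on_def by force
  qed
  ultimately have "((\<lambda>z. flow (fst z) (snd z)) \<longlongrightarrow> flow x0 t0) ?F"
    using tendsto_add by fastforce
  then show "((\<lambda>(x, t). flow x t) \<longlongrightarrow> flow x0 t0) ?F"
    by (simp add: case_prod_unfold)
qed

lemma flow_continuous_compose [continuous_intros]:
  fixes f g :: "'a::metric_space \<Rightarrow> real"
  assumes "continuous_on A f" "continuous_on A g" "f ` A \<subseteq> return_dom S" "g ` A \<subseteq> {0..1}"
  shows "continuous_on A (\<lambda>z. flow (f z) (g z))"
  using continuous_on_compose2[OF flow_continuous, of A "\<lambda>z. (f z, g z)"] assms
  by (auto intro!: continuous_intros)

text \<open>By \<open>solution_diff\<close> the difference quotient is itself an exponential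
  \<open>?E y\<close>, continuous in \<open>y\<close>; at \<open>y = x0\<close> the divided
  difference is taken on the diagonal and equals \<open>S_dx\<close>.\<close>

lemma flow_derivative:
  assumes x0: "x0 \<in> return_dom S" and t: "t \<in> {0..1}"
  shows "((\<lambda>y. flow y t) has_real_derivative
    exp (integral {0..t} (\<lambda>s. S_dx (flow x0 s) s))) (at x0)"
proof -
  let ?E = "\<lambda>y. exp (integral {0..t} (\<lambda>s. S_dd (flow y s) (flow x0 s) s))"
  have "continuous_on (return_dom S \<times> cbox 0 t) (\<lambda>(y, s). S_dd (flow y s) (flow x0 s) s)"
    using x0 t unfolding case_prod_unfold by (auto intro!: continuous_intros)
  then have "continuous_on (return_dom S) ?E"
    using integral_continuous_on_param by (fastforce intro!: continuous_intros)
  then have "?E \<midarrow>x0\<rightarrow> ?E x0"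
    using x0 open_return_dom by (simp add: continuous_on_eq_continuous_at isCont_def)
  moreover have "\<forall>\<^sub>F y in at x0. ?E y = (flow y t - flow x0 t) / (y - x0)"
  proof -
    have "\<forall>\<^sub>F y in at x0. y \<in> return_dom S"
      using x0 open_return_dom by (auto simp: eventually_at_topological)
    moreover have "\<forall>\<^sub>F y in at x0. y \<noteq> x0"
      by (simp add: eventually_at_filter)
    ultimately show ?thesis
    proof eventually_elim
      case (elim y)
      then show ?case
        using solution_diff[OF flow_solves[of y] flow_solves[OF x0] t] x0 by (simp add: flow_0)
    qed
  qed
  ultimately have "((\<lambda>y. (flow y t - flow x0 t) / (y - x0)) \<longlongrightarrow> ?E x0) (at x0)"
    by (rule Lim_transform_eventually)
  then show ?thesis
    by (simp add: has_field_derivative_iff poly_rhs_dd_same)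
qed

definition return_deriv :: "real \<Rightarrow> real" where
  "return_deriv x0 = exp (integral {0..1} (\<lambda>s. S_dx (flow x0 s) s))"

lemma return_deriv_eq:
  "solves S x \<Longrightarrow> return_deriv (x 0) = exp (integral {0..1} (\<lambda>s. S_dx (x s) s))"
  unfolding return_deriv_def by (intro arg_cong[where f = exp] integral_cong) (simp add: flow_eq)

lemma DERIV_return_map:
  assumes "x0 \<in> return_dom S"
  shows "(return_map S has_real_derivative return_deriv x0) (at x0)"
  using flow_derivative[OF assms, of 1] open_return_dom assms unfolding return_deriv_def
  by (rule has_field_derivative_transform_within_open) (simp_all add: return_map_flow)

text \<open>Differentiation under the integral sign in \<open>return_deriv\<close>; the inner
  exponential is the derivative of the flow and enters by the chain rule.\<close>

lemma DERIV_return_deriv: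
  assumes x: "solves S x"
  shows "(return_deriv has_real_derivative return_deriv (x 0) *
     integral {0..1} (\<lambda>t. S_dxx (x t) t * exp (integral {0..t} (\<lambda>s. S_dx (x s) s)))) (at (x 0))"
proof -
  have x0: "x 0 \<in> return_dom S" by (rule return_domI[OF x])
  \<comment> \<open>A ball, because the Leibniz rule asks for a convex parameter set.\<close>
  obtain r where r: "r > 0" "ball (x 0) r \<subseteq> return_dom S"
    using open_return_dom x0 open_contains_ball by blast
  have x_ball: "x 0 \<in> ball (x 0) r" using r by simp
  let ?f = "\<lambda>y t. S_dxx (flow y t) t * exp (integral {0..t} (\<lambda>s. S_dx (flow y s) s))"
  have "((\<lambda>y. integral (cbox 0 1) (\<lambda>t. S_dx (flow y t) t)) has_field_derivative
      integral (cbox 0 1) (?f (x 0))) (at (x 0) within ball (x 0) r)"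
  proof (rule leibniz_rule_field_derivative)
    fix y t :: real assume y: "y \<in> ball (x 0) r" and t: "t \<in> cbox 0 1"
    have "((\<lambda>y. S_dx (flow y t) t) has_field_derivative ?f y t) (at y)"
      using DERIV_chain2[OF DERIV_poly_rhs_dx flow_derivative[of y t], of m c t] y t r by auto
    then show "((\<lambda>y. S_dx (flow y t) t) has_field_derivative ?f y t) (at y within ball (x 0) r)"
      by (rule has_field_derivative_at_within)
  next
    fix y :: real assume y: "y \<in> ball (x 0) r"
    have "continuous_on (cbox 0 1) (\<lambda>t. S_dx (flow y t) t)"
      using y r by (auto intro!: continuous_intros)
    then show "(\<lambda>t. S_dx (flow y t) t) integrable_on cbox 0 1"
      by (rule integrable_continuous)
  next
    have "continuous_on (ball (x 0) r \<times> {0..1}) (\<lambda>(y, s). S_dx (flow y s) s)"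
      using r unfolding case_prod_unfold by (auto intro!: continuous_intros)
    from integral_upto_continuous[OF this]
    show "continuous_on (ball (x 0) r \<times> cbox 0 1) (\<lambda>(y, t). ?f y t)"
      using r unfolding case_prod_unfold by (auto intro!: continuous_intros)
  qed (use r in auto)
  then have "((\<lambda>y. integral {0..1} (\<lambda>t. S_dx (flow y t) t)) has_field_derivative
      integral {0..1} (?f (x 0))) (at (x 0))"
    unfolding at_within_open[OF x_ball open_ball] box_real .
  then have "(return_deriv has_real_derivative return_deriv (x 0) * integral {0..1} (?f (x 0))) (at (x 0))"
    unfolding return_deriv_def[abs_def] by (rule DERIV_fun_exp)
  moreover have "integral {0..1} (?f (x 0)) =
    integral {0..1} (\<lambda>t. S_dxx (x t) t * exp (integral {0..t} (\<lambda>s. S_dx (x s) s)))"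
  proof (rule integral_cong)
    fix t :: real assume t: "t \<in> {0..1}"
    have "integral {0..t} (\<lambda>s. S_dx (flow (x 0) s) s) = integral {0..t} (\<lambda>s. S_dx (x s) s)"
      using t by (intro integral_cong) (simp add: flow_eq[OF x])
    then show "?f (x 0) t = S_dxx (x t) t * exp (integral {0..t} (\<lambda>s. S_dx (x s) s))"
      using t by (simp add: flow_eq[OF x])
  qed
  ultimately show ?thesis by simp
qed

end

section \<open>Equations of alternating sign on parallel lines\<close>

lemma nondecreasing_on_unit:
  fixes w :: "real \<Rightarrow> real"
  assumes w: "\<And>t. t \<in> {0..1} \<Longrightarrow> (w has_real_derivative w' t) (at t within {0..1})"
    and w': "\<And>t. t \<in> {0..1} \<Longrightarrow> w' t \<ge> 0"
    and st: "0 \<le> s" "s \<le> t" "t \<le> 1"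
  shows "w s \<le> w t"
proof (rule DERIV_nonneg_imp_increasing_open[OF st(2)])
  fix r assume r: "s < r" "r < t"
  then have "(w has_real_derivative w' r) (at r)"
    using w[of r] st by (simp add: at_within_Icc_at)
  then show "\<exists>y. (w has_real_derivative y) (at r) \<and> y \<ge> 0"
    using w'[of r] r st by auto
next
  have "continuous_on {0..1} w" using w by (rule DERIV_continuous_on)
  then show "continuous_on {s..t} w" by (rule continuous_on_subset) (use st in auto)
qed

lemma same_side_of_avoided:
  fixes x :: "real \<Rightarrow> real"
  assumes x: "continuous_on {0..1} x" and k: "\<And>t. t \<in> {0..1} \<Longrightarrow> x t \<noteq> k" and t: "t \<in> {0..1}"
  shows "x t < k \<longleftrightarrow> x 0 < k"
proof -
  have "connected (x ` {0..1})" by (intro connected_continuous_image x) simp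
  moreover have "k \<notin> x ` {0..1}" using k by blast
  ultimately show ?thesis
    using connectedD_interval[of "x ` {0..1}" "x t" "x 0" k]
      connectedD_interval[of "x ` {0..1}" "x 0" "x t" k] t k[of t] k[of 0]
    by fastforce
qed

text \<open>Substitution \<open>y = x(t)\<close>. The difference of two integrals is the oriented
  integral, since at least one of them runs over an empty or one-point interval; it vanishes when
  \<open>x 0 = x 1\<close>.\<close>

lemma integral_along:
  fixes x g :: "real \<Rightarrow> real"
  assumes x: "\<And>t. t \<in> {0..1} \<Longrightarrow> (x has_real_derivative x' t) (at t within {0..1})"
    and g: "continuous_on (x ` {0..1}) g"
  shows "((\<lambda>t. x' t * g (x t)) has_integral (integral {x 0..x 1} g - integral {x 1..x 0} g)) {0..1}"
proof -
  have c: "continuous_on {0..1} x" using x by (rule DERIV_continuous_on)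
  obtain u v where "x ` {0..1} = {u..v}"
    using continuous_image_closed_interval[OF _ c] by auto
  then show ?thesis
    using has_integral_substitution_general[of "{}" 0 1 x u v g x'] x g c by simp
qed

text \<open>Here \<open>poly_rhs m c\<close> is the \<open>R\<close> of the overview. The identity
  \<open>R = W F\<close> is stated with denominators multiplied out, so that it covers the points of
  \<open>L\<close>; of \<open>sg\<close> only the sign matters.\<close>

locale alternating_equation = polynomial_equation +
  fixes L :: "real set" and q :: "real \<Rightarrow> real \<Rightarrow> real" and p :: "real \<Rightarrow> real" and sg :: real
  assumes finite_L: "finite L"
    and q_cont: "k \<in> L \<Longrightarrow> continuous_on {0..1} (q k)"
    and p_cont: "continuous_on {0..1} p"
    and q_sign: "k \<in> L \<Longrightarrow> t \<in> {0..1} \<Longrightarrow> sg * q k t \<ge> 0"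
    and sg: "sg \<noteq> 0"
    and S_eq: "t \<in> {0..1} \<Longrightarrow>
      poly_rhs m c y t = p t * (\<Prod>k\<in>L. y - k) + (\<Sum>k\<in>L. q k t * (\<Prod>j\<in>L - {k}. y - j))"
begin

section \<open>The factorization \<open>S = W F\<close> and its space derivatives\<close>

definition K where "K = {k \<in> L. \<exists>t\<in>{0..1}. q k t \<noteq> 0}"

definition W :: "real poly" where "W = (\<Prod>k\<in>L. [:- k, 1:])"

text \<open>Summing over \<open>K\<close> instead of \<open>L\<close> makes \<open>F\<close> regular
  at the points of \<open>L - K\<close>, which are the roots that can be periodic.\<close>

definition F where "F y t = p t + (\<Sum>k\<in>K. q k t / (y - k))"

definition F_dx where "F_dx y t = - (\<Sum>k\<in>K. q k t / (y - k)\<^sup>2)"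

lemma K_subset: "K \<subseteq> L" and finite_K: "finite K"
  using finite_L by (auto simp: K_def)

lemma poly_W: "poly W y = (\<Prod>k\<in>L. y - k)"
  by (simp add: W_def poly_prod)

lemma poly_W_eq_0_iff: "poly W y = 0 \<longleftrightarrow> y \<in> L"
  using finite_L by (simp add: poly_W)

lemma pderiv_W: "k \<in> L \<Longrightarrow> poly (pderiv W) k \<noteq> 0"
proof -
  assume k: "k \<in> L"
  then have "W = [:- k, 1:] * (\<Prod>k\<in>L - {k}. [:- k, 1:])"
    unfolding W_def using finite_L by (simp only: prod.remove)
  then have "poly (pderiv W) k = (\<Prod>j\<in>L - {k}. k - j)"
    by (simp only: pderiv_mult) (simp add: poly_prod pderiv_pCons)
  then show ?thesis using finite_L by simp
qed

text \<open>Terms of the interpolation formula with \<open>k \<notin> K\<close> vanish on [0,1]; in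
  the others \<open>y \<noteq> k\<close>, so the missing factor can be restored and divided
  out.\<close>

lemma S_factor:
  assumes t: "t \<in> {0..1}" and y: "y \<notin> K"
  shows "S y t = poly W y * F y t"
proof -
  have "(\<Sum>k\<in>L. q k t * (\<Prod>j\<in>L - {k}. y - j)) = (\<Sum>k\<in>L. if k \<in> K then poly W y * (q k t / (y - k)) else 0)"
  proof (rule sum.cong)
    fix k assume k: "k \<in> L"
    show "q k t * (\<Prod>j\<in>L - {k}. y - j) = (if k \<in> K then poly W y * (q k t / (y - k)) else 0)"
    proof (cases "k \<in> K")
      case True
      then have "y \<noteq> k" using y by auto
      then show ?thesis using True prod.remove[OF finite_L k, of "\<lambda>j. y - j"] by (simp add: poly_W)
    next
      case False
      then show ?thesis using k t by (auto simp: K_def)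
    qed
  qed simp
  also have "\<dots> = (\<Sum>k\<in>K. poly W y * (q k t / (y - k)))"
    using K_subset finite_L by (simp add: sum.If_cases Int_absorb1)
  finally show ?thesis
    by (simp add: S_eq[OF t] F_def poly_W algebra_simps sum_distrib_left)
qed

lemma DERIV_F: "y \<notin> K \<Longrightarrow> ((\<lambda>y. F y t) has_real_derivative F_dx y t) (at y)"
  unfolding F_def F_dx_def sum_negf[symmetric]
  by (rule DERIV_cong[OF DERIV_add[OF DERIV_const DERIV_sum]])
    (auto intro!: derivative_eq_intros simp: power2_eq_square)

lemma open_compl_K: "open (- K)"
  by (intro open_Compl finite_imp_closed finite_K)

lemma S_dx_factor:
  assumes "t \<in> {0..1}" "y \<notin> K"
  shows "S_dx y t = poly (pderiv W) y * F y t + poly W y * F_dx y t"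
proof (rule DERIV_unique[OF DERIV_poly_rhs])
  have "((\<lambda>y. poly W y * F y t) has_real_derivative
      poly (pderiv W) y * F y t + poly W y * F_dx y t) (at y)"
    by (rule DERIV_cong[OF DERIV_mult[OF poly_DERIV DERIV_F]]) (use assms in auto)
  then show "((\<lambda>y. S y t) has_real_derivative
      poly (pderiv W) y * F y t + poly W y * F_dx y t) (at y)"
    by (rule has_field_derivative_transform_within_open[OF _ open_compl_K])
      (use assms in \<open>auto simp: S_factor\<close>)
qed

text \<open>The derivative \<open>D\<close> of \<open>F_dx\<close> comes multiplied by
  \<open>W\<close>, which vanishes at the root, so only its existence counts and not its
  value.\<close>

lemma S_dxx_at_root:
  assumes t: "t \<in> {0..1}" and y: "y \<in> L - K"
  shows "S_dxx y t = poly (pderiv (pderiv W)) y * F y t + 2 * poly (pderiv W) y * F_dx y t"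
proof (rule DERIV_unique[OF DERIV_poly_rhs_dx])
  have yK: "y \<notin> K" using y by auto
  have "((\<lambda>y. q k t / (y - k)\<^sup>2) has_real_derivative
      (0 * (y - k)\<^sup>2 - q k t * (2 * (y - k))) / ((y - k)\<^sup>2 * (y - k)\<^sup>2)) (at y)" if "k \<in> K" for k
    using that yK by (intro DERIV_divide DERIV_const) (auto intro!: derivative_eq_intros)
  then have "((\<lambda>y. - (\<Sum>k\<in>K. q k t / (y - k)\<^sup>2)) has_real_derivative
      - (\<Sum>k\<in>K. (0 * (y - k)\<^sup>2 - q k t * (2 * (y - k))) / ((y - k)\<^sup>2 * (y - k)\<^sup>2))) (at y)"
    by (intro DERIV_minus DERIV_sum)
  then obtain D where D: "((\<lambda>y. F_dx y t) has_real_derivative D) (at y)"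
    unfolding F_dx_def by blast
  have "((\<lambda>y. poly (pderiv W) y * F y t + poly W y * F_dx y t) has_real_derivative
      (poly (pderiv (pderiv W)) y * F y t + F_dx y t * poly (pderiv W) y) +
      (poly (pderiv W) y * F_dx y t + D * poly W y)) (at y)"
    by (intro DERIV_add DERIV_mult poly_DERIV DERIV_F yK D)
  then have "((\<lambda>y. poly (pderiv W) y * F y t + poly W y * F_dx y t) has_real_derivative
      poly (pderiv (pderiv W)) y * F y t + 2 * poly (pderiv W) y * F_dx y t) (at y)"
    by (rule DERIV_cong) (use y poly_W_eq_0_iff in auto)
  then show "((\<lambda>y. S_dx y t) has_real_derivative
      poly (pderiv (pderiv W)) y * F y t + 2 * poly (pderiv W) y * F_dx y t) (at y)"
    by (rule has_field_derivative_transform_within_open[OF _ open_compl_K])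
      (use t yK in \<open>auto simp: S_dx_factor\<close>)
qed

lemma F_continuous:
  assumes "continuous_on {0..1} x" "\<And>t. t \<in> {0..1} \<Longrightarrow> x t \<notin> K"
  shows "continuous_on {0..1} (\<lambda>t. F (x t) t)" "continuous_on {0..1} (\<lambda>t. F_dx (x t) t)"
  unfolding F_def F_dx_def using assms K_subset
  by (auto intro!: continuous_intros p_cont q_cont)

text \<open>After multiplication by \<open>sg\<close> all summands are nonnegative. If the integral
  were 0, the continuous integrand would vanish identically, but each \<open>k \<in> K\<close> has a
  time with \<open>q k t \<noteq> 0\<close>.\<close>

lemma K_integral_pos:
  assumes "K \<noteq> {}" and h: "\<And>k. k \<in> K \<Longrightarrow> continuous_on {0..1} (h k)"
    "\<And>k t. k \<in> K \<Longrightarrow> t \<in> {0..1} \<Longrightarrow> h k t > 0"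
  shows "sg * integral {0..1} (\<lambda>t. \<Sum>k\<in>K. q k t * h k t) > 0"
proof -
  let ?f = "\<lambda>t. \<Sum>k\<in>K. sg * q k t * h k t"
  have c: "continuous_on {0..1} ?f"
    using K_subset by (intro continuous_intros h q_cont) auto
  have nn: "sg * q k t * h k t \<ge> 0" if "k \<in> K" "t \<in> {0..1}" for k t
    using q_sign[of k t] h(2)[of k t] K_subset that by auto
  then have nn': "?f t \<ge> 0" if "t \<in> {0..1}" for t
    using that by (intro sum_nonneg) auto
  have "integral {0..1} ?f \<noteq> 0"
  proof
    assume "integral {0..1} ?f = 0"
    then have 0: "?f t = 0" if "t \<in> {0..1}" for t
      using integral_eq_0_iff[OF c] nn' that by auto
    obtain k t where k: "k \<in> K" "t \<in> {0..1}" "q k t \<noteq> 0" using assms(1) unfolding K_def by blast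
    from 0[OF k(2)] have "sg * q k t * h k t = 0"
      using nn k finite_K by (subst (asm) sum_nonneg_eq_0_iff) auto
    then show False using k h(2)[of k t] sg by auto
  qed
  moreover have "integral {0..1} ?f \<ge> 0"
    using nn' by (intro integral_nonneg integrable_continuous_real c) auto
  moreover have "integral {0..1} ?f = sg * integral {0..1} (\<lambda>t. \<Sum>k\<in>K. q k t * h k t)"
    by (simp add: mult.assoc flip: sum_distrib_left)
  ultimately show ?thesis by (metis order_less_le)
qed

text \<open>The sign of \<open>S(k,t)\<close> does not depend on \<open>t\<close>, so that \<open>x - k\<close> times an integrating factor
  is monotone.\<close>

lemma periodic_through_root:
  assumes x: "solves S x" "x 1 = x 0" and k: "k \<in> L" and t0: "t0 \<in> {0..1}" "x t0 = k"
  shows "k \<notin> K" "\<And>t. t \<in> {0..1} \<Longrightarrow> x t = k"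
proof -
  define P where "P = (\<Prod>j\<in>L - {k}. k - j)"
  have P: "P \<noteq> 0" using finite_L by (simp add: P_def)
  have Sk: "S k t = q k t * P" if "t \<in> {0..1}" for t
  proof -
    have "(\<Sum>i\<in>L. q i t * (\<Prod>j\<in>L - {i}. k - j)) = (\<Sum>i\<in>L. if i = k then q k t * P else 0)"
    proof (rule sum.cong)
      fix i assume "i \<in> L"
      show "q i t * (\<Prod>j\<in>L - {i}. k - j) = (if i = k then q k t * P else 0)"
        using finite_L k by (auto simp: P_def)
    qed simp
    then show ?thesis using that k finite_L by (simp add: S_eq)
  qed
  define I where "I t = integral {0..t} (\<lambda>s. S_dd (x s) k s)" for t
  \<comment> \<open>The factor \<open>sg * P\<close> makes the derivative a product of
    \<open>sg * q k t\<close>, the square of \<open>P\<close> and an exponential, hence nonnegative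
    whatever the sign of \<open>P\<close>.\<close>
  define w where "w t = sg * P * (x t - k) * exp (- I t)" for t
  have xc: "continuous_on {0..1} x" by (rule solves_continuous[OF x(1)])
  have I: "(I has_real_derivative S_dd (x t) k t) (at t within {0..1})" if "t \<in> {0..1}" for t
    unfolding I_def using that xc
    by (intro integral_has_real_derivative continuous_intros) auto
  have w': "(w has_real_derivative (sg * q k t) * (P * P) * exp (- I t)) (at t within {0..1})"
    if t: "t \<in> {0..1}" for t
  proof -
    have "S (x t) t = S_dd (x t) k t * (x t - k) + q k t * P"
      using poly_rhs_diff[of m c "x t" t k] Sk[OF t] by simp
    then have "((\<lambda>t. x t - k) has_real_derivative S_dd (x t) k t * (x t - k) + q k t * P) (at t within {0..1})"
      using x t unfolding solves_def by (auto intro!: derivative_eq_intros)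
    moreover have "((\<lambda>t. exp (- I t)) has_real_derivative - S_dd (x t) k t * exp (- I t)) (at t within {0..1})"
      using I[OF t] by (auto intro!: derivative_eq_intros)
    ultimately show ?thesis unfolding w_def mult.assoc[of "sg * P"]
      by (rule DERIV_cong[OF DERIV_cmult[OF DERIV_mult]]) (simp add: algebra_simps)
  qed
  have mono: "w s \<le> w t" if "0 \<le> s" "s \<le> t" "t \<le> 1" for s t
    using nondecreasing_on_unit[OF w' _ that] q_sign[OF k] by auto
  \<comment> \<open>A monotone \<open>w\<close> with a zero at \<open>t0\<close> puts
    \<open>x 0\<close> and \<open>x 1\<close> weakly on opposite sides of \<open>k\<close>;
    periodicity forces both to equal \<open>k\<close>, and then \<open>w\<close> vanishes
    throughout.\<close>
  have "w t0 = 0" using t0 by (simp add: w_def)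
  then have "w 0 \<le> 0" "w 1 \<ge> 0" using mono[of 0 t0] mono[of t0 1] t0 by auto
  then have "sg * P * (x 0 - k) \<le> 0" "sg * P * (x 0 - k) \<ge> 0"
    using x(2) by (auto simp: w_def mult_le_0_iff zero_le_mult_iff)
  then have "sg * P * (x 0 - k) = 0" by simp
  then have x0: "x 0 = k" using sg P by simp
  show xk: "x t = k" if "t \<in> {0..1}" for t
  proof -
    have "w t = 0" using mono[of 0 t] mono[of t 1] that x0 x(2) by (auto simp: w_def)
    then show ?thesis using sg P by (simp add: w_def)
  qed
  show "k \<notin> K"
  proof
    assume "k \<in> K"
    then obtain t where t: "t \<in> {0..1}" "q k t \<noteq> 0" by (auto simp: K_def)
    have "(x has_real_derivative q k t * P) (at t within {0..1})"
      using x(1) t xk[of t] Sk[of t] unfolding solves_def by force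
    moreover have "(x has_real_derivative 0) (at t within {0..1})"
      by (rule has_field_derivative_transform_within[OF DERIV_const[of k] zero_less_one t(1)])
        (simp add: xk)
    ultimately have "q k t * P = 0"
      using t vector_derivative_within_closed_interval[of 0 1 t x "q k t * P"]
        vector_derivative_within_closed_interval[of 0 1 t x 0]
      unfolding has_real_derivative_iff_has_vector_derivative by simp
    then show False using P t by simp
  qed
qed

section \<open>Location and number of periodic solutions\<close>

lemma periodic_avoids_K: "solves S x \<Longrightarrow> x 1 = x 0 \<Longrightarrow> t \<in> {0..1} \<Longrightarrow> x t \<notin> K"
  using periodic_through_root(1) K_subset by blast

lemma periodic_avoids_L:
  "solves S x \<Longrightarrow> x 1 = x 0 \<Longrightarrow> x 0 \<notin> L \<Longrightarrow> t \<in> {0..1} \<Longrightarrow> x t \<notin> L"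
  using periodic_through_root(2)[of x "x t" t 0] by auto

text \<open>Along the solution \<open>F dt\<close> is \<open>dy / W\<close>, because
  \<open>S = W F\<close>.\<close>

lemma integral_F:
  assumes x: "solves S x" and xL: "\<And>t. t \<in> {0..1} \<Longrightarrow> x t \<notin> L"
  shows "((\<lambda>t. F (x t) t) has_integral
    (integral {x 0..x 1} (\<lambda>y. 1 / poly W y) - integral {x 1..x 0} (\<lambda>y. 1 / poly W y))) {0..1}"
proof -
  have "((\<lambda>t. S (x t) t * (1 / poly W (x t))) has_integral
    (integral {x 0..x 1} (\<lambda>y. 1 / poly W y) - integral {x 1..x 0} (\<lambda>y. 1 / poly W y))) {0..1}"
  proof (rule integral_along)
    show "continuous_on (x ` {0..1}) (\<lambda>y. 1 / poly W y)"
      using xL by (auto intro!: continuous_intros simp: poly_W_eq_0_iff)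
  qed (use x in \<open>auto simp: solves_def\<close>)
  then show ?thesis
  proof (rule has_integral_eq[rotated])
    fix t :: real assume t: "t \<in> {0..1}"
    show "S (x t) t * (1 / poly W (x t)) = F (x t) t"
      using xL[OF t] K_subset by (subst S_factor[OF t]) (auto simp: poly_W_eq_0_iff)
  qed
qed

text \<open>The condition is imposed on roots as well: \<open>E\<close> contains every periodic
  solution off \<open>L\<close>, and also the periodic roots at which the return map has derivative
  1.\<close>

definition E where
  "E = {x0. \<exists>x. solves S x \<and> x 1 = x 0 \<and> x 0 = x0 \<and> integral {0..1} (\<lambda>t. F (x t) t) = 0}"

lemma E_iff:
  assumes "solves S x" "x 1 = x 0"
  shows "x 0 \<in> E \<longleftrightarrow> integral {0..1} (\<lambda>t. F (x t) t) = 0"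
proof
  assume "x 0 \<in> E"
  then obtain y where y: "solves S y" "y 1 = y 0" "y 0 = x 0" "integral {0..1} (\<lambda>t. F (y t) t) = 0"
    by (auto simp: E_def)
  have "integral {0..1} (\<lambda>t. F (y t) t) = integral {0..1} (\<lambda>t. F (x t) t)"
    by (intro integral_cong) (simp add: solution_unique[OF y(1) assms(1) y(3)])
  with y show "integral {0..1} (\<lambda>t. F (x t) t) = 0" by simp
qed (use assms in \<open>auto simp: E_def\<close>)

text \<open>Off \<open>L\<close>, the integral of \<open>dy / W\<close> from \<open>x 0\<close> back
  to itself is 0; on \<open>L\<close>, a periodic solution misses the poles.\<close>

lemma periodic_init:
  assumes "solves S x" "x 1 = x 0"
  shows "x 0 \<in> (L - K) \<union> E"
proof (cases "x 0 \<in> L")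
  case True
  then show ?thesis using periodic_avoids_K[OF assms, of 0] by auto
next
  case False
  from integral_F[OF assms(1) periodic_avoids_L[OF assms False]] assms
  show ?thesis by (simp add: E_iff integral_unique)
qed

lemma K_empty_integral_F: "K = {} \<Longrightarrow> F y t = p t"
  by (simp add: F_def)

text \<open>Otherwise both solutions lie on the same side of every pole, so each
  \<open>1 / (x t - k)\<close> exceeds \<open>1 / (y t - k)\<close>. As all \<open>q k\<close> have
  one sign, the integrals of \<open>F\<close> along the two solutions differ.\<close>

lemma E_separated:
  assumes K: "K \<noteq> {}" and e: "e1 \<in> E" "e2 \<in> E" "e1 < e2"
  shows "\<exists>k\<in>K. e1 < k \<and> k < e2"
proof (rule ccontr)
  assume no: "\<not> ?thesis"
  obtain x y where x: "solves S x" "x 1 = x 0" "x 0 = e1" "integral {0..1} (\<lambda>t. F (x t) t) = 0"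
    and y: "solves S y" "y 1 = y 0" "y 0 = e2" "integral {0..1} (\<lambda>t. F (y t) t) = 0"
    using e by (auto simp: E_def)
  have xc: "continuous_on {0..1} x" and yc: "continuous_on {0..1} y"
    by (intro solves_continuous x y)+
  have xK: "x t \<noteq> k" and yK: "y t \<noteq> k" if "k \<in> K" "t \<in> {0..1}" for k t
    using periodic_avoids_K[OF x(1,2), of t] periodic_avoids_K[OF y(1,2), of t] that by auto
  \<comment> \<open>Solutions do not cross.\<close>
  have lt: "x t < y t" if "t \<in> {0..1}" for t
  proof -
    have "y t - x t > 0"
      unfolding solution_diff[OF y(1) x(1) that] using e x y by (intro mult_pos_pos) auto
    then show ?thesis by simp
  qed
  have pos: "1 / (x t - k) - 1 / (y t - k) > 0" if k: "k \<in> K" and t: "t \<in> {0..1}" for k t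
  proof -
    have "x t < k \<longleftrightarrow> y t < k"
      using same_side_of_avoided[OF xc xK[OF k] t] same_side_of_avoided[OF yc yK[OF k] t]
        xK[OF k, of 0] yK[OF k, of 0] no k x(3) y(3) e(3) by force
    then have "(x t - k) * (y t - k) > 0"
      using xK[OF k t] yK[OF k t] by (auto simp: zero_less_mult_iff)
    moreover have "1 / (x t - k) - 1 / (y t - k) = (y t - x t) / ((x t - k) * (y t - k))"
      using xK[OF k t] yK[OF k t] by (simp add: field_simps)
    ultimately show ?thesis using lt[OF t] by simp
  qed
  have "0 < sg * integral {0..1} (\<lambda>t. \<Sum>k\<in>K. q k t * (1 / (x t - k) - 1 / (y t - k)))"
    by (rule K_integral_pos[OF K]) (use pos xK yK xc yc in \<open>auto intro!: continuous_intros\<close>)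
  also have "(\<lambda>t. \<Sum>k\<in>K. q k t * (1 / (x t - k) - 1 / (y t - k))) = (\<lambda>t. F (x t) t - F (y t) t)"
    by (simp add: F_def right_diff_distrib sum_subtractf)
  also have "integral {0..1} \<dots> = 0"
    using x(4) y(4) F_continuous(1)[OF xc] F_continuous(1)[OF yc] xK yK
    by (subst integral_diff) (auto intro!: integrable_continuous_real)
  finally show False by simp
qed

text \<open>A periodic solution above all the poles forces \<open>\<integral> p\<close> to have the sign opposite to \<open>sg\<close>,
  one below all of them the same sign.\<close>

lemma E_outer:
  assumes K: "K \<noteq> {}" and e: "e \<in> E"
  shows "sg * integral {0..1} p \<ge> 0 \<Longrightarrow> \<exists>k\<in>K. e < k"
    and "sg * integral {0..1} p \<le> 0 \<Longrightarrow> \<exists>k\<in>K. k < e"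
proof -
  obtain x where x: "solves S x" "x 1 = x 0" "x 0 = e" "integral {0..1} (\<lambda>t. F (x t) t) = 0"
    using e by (auto simp: E_def)
  have xc: "continuous_on {0..1} x"
    by (intro solves_continuous x)
  have xK: "x t \<noteq> k" if "k \<in> K" "t \<in> {0..1}" for k t
    using periodic_avoids_K[OF x(1,2), of t] that by auto
  have side: "x t < k \<longleftrightarrow> e < k" if "k \<in> K" "t \<in> {0..1}" for k t
    using same_side_of_avoided[OF xc xK[OF that(1)] that(2)] x by simp
  let ?G = "\<lambda>t. \<Sum>k\<in>K. q k t * (1 / (x t - k))"
  have G: "continuous_on {0..1} ?G"
    using K_subset xK xc by (auto intro!: continuous_intros q_cont)
  have "0 = integral {0..1} (\<lambda>t. p t + ?G t)" using x(4) by (simp add: F_def)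
  also have "\<dots> = integral {0..1} p + integral {0..1} ?G"
    by (intro integral_add integrable_continuous_real p_cont G)
  finally have *: "integral {0..1} p = - integral {0..1} ?G" by simp
  show "\<exists>k\<in>K. e < k" if "sg * integral {0..1} p \<ge> 0"
  proof (rule ccontr)
    assume no: "\<not> ?thesis"
    have "0 < sg * integral {0..1} ?G"
      by (rule K_integral_pos[OF K]) (use no side xK xc in \<open>force intro!: continuous_intros\<close>)+
    then show False using that by (simp add: *)
  qed
  show "\<exists>k\<in>K. k < e" if "sg * integral {0..1} p \<le> 0"
  proof (rule ccontr)
    assume no: "\<not> ?thesis"
    \<comment> \<open>Below all poles the fractions are negative; \<open>1 / (k - x t)\<close>
      provides the positive weights.\<close>
    have "x t < k" if "k \<in> K" "t \<in> {0..1}" for k t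
      using side[OF that] no that xK[OF that(1), of 0] x(3) by force
    then have "0 < sg * integral {0..1} (\<lambda>t. \<Sum>k\<in>K. q k t * (1 / (k - x t)))"
      using xK xc by (intro K_integral_pos[OF K]) (force intro!: continuous_intros)+
    also have "(\<lambda>t. \<Sum>k\<in>K. q k t * (1 / (k - x t))) = (\<lambda>t. - ?G t)"
      unfolding sum_negf[symmetric] by (intro ext sum.cong) (auto simp: minus_divide_right)
    finally show False using that by (simp add: *)
  qed
qed

text \<open>Each \<open>e\<close> is sent to its nearest pole, above or below according to the sign
  of \<open>sg\<close> times the integral of \<open>p\<close>; \<open>E_outer\<close> provides such
  a pole, and \<open>E_separated\<close> makes the map injective.\<close>

lemma E_card:
  assumes K: "K \<noteq> {}"
  shows "finite E" "card E \<le> card K"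
proof -
  have "\<exists>f. inj_on f E \<and> f ` E \<subseteq> K"
  proof (cases "sg * integral {0..1} p \<ge> 0")
    case True
    define f where "f e = Min {k \<in> K. e < k}" for e
    have f: "f e \<in> K" "e < f e" "\<And>k. k \<in> K \<Longrightarrow> e < k \<Longrightarrow> f e \<le> k" if "e \<in> E" for e
    proof -
      have ne: "{k \<in> K. e < k} \<noteq> {}" using E_outer(1)[OF K that] True by auto
      show "f e \<in> K" "e < f e" using Min_in[OF _ ne] finite_K by (auto simp: f_def)
      show "f e \<le> k" if "k \<in> K" "e < k" for k
        using that finite_K by (auto simp: f_def intro: Min_le)
    qed
    have "f e1 \<noteq> f e2" if "e1 \<in> E" "e2 \<in> E" "e1 < e2" for e1 e2
      using E_separated[OF K that] f(2)[OF that(2)] f(3)[OF that(1)] by force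
    then show ?thesis using f(1) by (intro exI[of _ f]) (auto intro: linorder_inj_onI')
  next
    case False
    define f where "f e = Max {k \<in> K. k < e}" for e
    have f: "f e \<in> K" "f e < e" "\<And>k. k \<in> K \<Longrightarrow> k < e \<Longrightarrow> k \<le> f e" if "e \<in> E" for e
    proof -
      have ne: "{k \<in> K. k < e} \<noteq> {}" using E_outer(2)[OF K that] False by auto
      show "f e \<in> K" "f e < e" using Max_in[OF _ ne] finite_K by (auto simp: f_def)
      show "k \<le> f e" if "k \<in> K" "k < e" for k
        using that finite_K by (auto simp: f_def intro: Max_ge)
    qed
    have "f e1 \<noteq> f e2" if "e1 \<in> E" "e2 \<in> E" "e1 < e2" for e1 e2
      using E_separated[OF K that] f(2)[OF that(1)] f(3)[OF that(2)] by force
    then show ?thesis using f(1) by (intro exI[of _ f]) (auto intro: linorder_inj_onI')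
  qed
  then obtain f where "inj_on f E" "f ` E \<subseteq> K" by blast
  then show "finite E" "card E \<le> card K"
    using finite_K by (auto intro: inj_on_finite card_inj_on_le)
qed

end

section \<open>Multiplicities, and the degenerate case\<close>

context alternating_equation
begin

text \<open>In \<open>S_dx = W' F + W F_dx\<close> the first term equals \<open>S W' / W\<close>,
  the time derivative of \<open>ln \<bar>W\<bar>\<close>, and integrates to 0 over a period. The
  second has a constant sign and a nonzero integral.\<close>

lemma return_deriv_ne_1_off_L:
  assumes K: "K \<noteq> {}" and x: "solves S x" "x 1 = x 0" and x0: "x 0 \<notin> L"
  shows "return_deriv (x 0) \<noteq> 1"
proof -
  have xc: "continuous_on {0..1} x" by (rule solves_continuous[OF x(1)])
  have xL: "x t \<notin> L" if "t \<in> {0..1}" for t using periodic_avoids_L[OF x x0 that] .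
  then have xK: "x t \<notin> K" if "t \<in> {0..1}" for t using that K_subset by auto
  have Wx: "poly W (x t) \<noteq> 0" if "t \<in> {0..1}" for t using xL[OF that] by (simp add: poly_W_eq_0_iff)
  have "((\<lambda>t. S (x t) t * (poly (pderiv W) (x t) / poly W (x t))) has_integral
      (integral {x 0..x 1} (\<lambda>y. poly (pderiv W) y / poly W y)
      - integral {x 1..x 0} (\<lambda>y. poly (pderiv W) y / poly W y))) {0..1}"
  proof (rule integral_along)
    show "continuous_on (x ` {0..1}) (\<lambda>y. poly (pderiv W) y / poly W y)"
      using Wx by (auto intro!: continuous_intros)
  qed (use x in \<open>auto simp: solves_def\<close>)
  then have "((\<lambda>t. S (x t) t * (poly (pderiv W) (x t) / poly W (x t))) has_integral 0) {0..1}"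
    using x by simp
  then have 1: "((\<lambda>t. poly (pderiv W) (x t) * F (x t) t) has_integral 0) {0..1}"
    by (rule has_integral_eq[rotated]) (use Wx xK in \<open>simp add: S_factor\<close>)
  \<comment> \<open>\<open>W\<close> has no zero along the solution, hence the constant sign
    \<open>s\<close>; this makes the weights \<open>\<bar>W\<bar> / (x t - k)\<^sup>2\<close>
    positive.\<close>
  define s where "s = sgn (poly W (x 0))"
  have s: "\<bar>poly W (x t)\<bar> = s * poly W (x t)" if t: "t \<in> {0..1}" for t
  proof -
    have "poly W (x t) < 0 \<longleftrightarrow> poly W (x 0) < 0"
      by (rule same_side_of_avoided[where x = "\<lambda>t. poly W (x t)"])
        (use Wx t xc in \<open>auto intro!: continuous_intros\<close>)
    then show ?thesis using Wx[OF t] Wx[of 0] by (auto simp: s_def sgn_if)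
  qed
  let ?D = "\<lambda>t. poly W (x t) * F_dx (x t) t"
  have "0 < sg * integral {0..1} (\<lambda>t. \<Sum>k\<in>K. q k t * (\<bar>poly W (x t)\<bar> / (x t - k)\<^sup>2))"
  proof (rule K_integral_pos[OF K])
    fix k assume k: "k \<in> K"
    then have xk: "x t \<noteq> k" if "t \<in> {0..1}" for t using xK[OF that] by auto
    then show "continuous_on {0..1} (\<lambda>t. \<bar>poly W (x t)\<bar> / (x t - k)\<^sup>2)"
      using xc by (auto intro!: continuous_intros)
    show "0 < \<bar>poly W (x t)\<bar> / (x t - k)\<^sup>2" if "t \<in> {0..1}" for t
      using Wx[OF that] xk[OF that] by (intro divide_pos_pos) auto
  qed
  also have "integral {0..1} (\<lambda>t. \<Sum>k\<in>K. q k t * (\<bar>poly W (x t)\<bar> / (x t - k)\<^sup>2))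
      = integral {0..1} (\<lambda>t. - s * ?D t)"
    by (intro integral_cong) (auto simp: s F_dx_def sum_distrib_left sum_negf mult_ac)
  also have "\<dots> = - s * integral {0..1} ?D"
    by simp
  finally have 2: "integral {0..1} ?D \<noteq> 0" by auto
  have "integral {0..1} (\<lambda>t. S_dx (x t) t)
      = integral {0..1} (\<lambda>t. poly (pderiv W) (x t) * F (x t) t + ?D t)"
    by (intro integral_cong) (simp add: S_dx_factor xK)
  also have "\<dots> = integral {0..1} ?D"
    using integral_unique[OF 1] xK xc F_continuous[OF xc xK]
    by (subst integral_add) (auto intro!: integrable_continuous_real continuous_intros)
  finally show ?thesis using 2 by (simp add: return_deriv_eq[OF x(1)])
qed

lemma at_periodic_root:
  assumes x: "solves S x" "x 1 = x 0" and x0: "x 0 \<in> L"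
  shows "x 0 \<in> L - K" "\<And>t. t \<in> {0..1} \<Longrightarrow> x t = x 0"
    and "t \<in> {0..1} \<Longrightarrow> S_dx (x t) t = poly (pderiv W) (x 0) * F (x 0) t"
proof -
  show 1: "x 0 \<in> L - K" using periodic_avoids_K[OF x, of 0] x0 by auto
  show 2: "x t = x 0" if "t \<in> {0..1}" for t
    by (rule periodic_through_root(2)[OF x x0, of 0]) (use that in auto)
  show "S_dx (x t) t = poly (pderiv W) (x 0) * F (x 0) t" if "t \<in> {0..1}"
    using 1 that poly_W_eq_0_iff[of "x 0"] unfolding 2[OF that] by (simp add: S_dx_factor)
qed

text \<open>The solution is constant and the roots of \<open>W\<close> are simple, so the exponent
  of \<open>return_deriv\<close> is a nonzero multiple of the integral of \<open>F\<close>.\<close>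

lemma return_deriv_ne_1_on_L:
  assumes x: "solves S x" "x 1 = x 0" and x0: "x 0 \<in> L" "x 0 \<notin> E"
  shows "return_deriv (x 0) \<noteq> 1"
proof -
  have "integral {0..1} (\<lambda>t. F (x t) t) = integral {0..1} (F (x 0))"
    by (intro integral_cong arg_cong2[where f = F] at_periodic_root(2)[OF x x0(1)]) auto
  then have "integral {0..1} (F (x 0)) \<noteq> 0" using x0(2) by (simp add: E_iff[OF x])
  moreover have "integral {0..1} (\<lambda>t. S_dx (x t) t)
      = integral {0..1} (\<lambda>t. poly (pderiv W) (x 0) * F (x 0) t)"
    by (intro integral_cong at_periodic_root(3)[OF x x0(1)])
  ultimately show ?thesis using pderiv_W[OF x0(1)] by (simp add: return_deriv_eq[OF x(1)])
qed

text \<open>In the second derivative of the return map, \<open>S_dxx = W'' F + 2 W' F_dx\<close> is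
  weighted with \<open>exp (w * A t)\<close>. The \<open>F\<close> part is an exact derivative and
  integrates to 0; the \<open>F_dx\<close> part has a strict sign.\<close>

lemma DERIV_return_deriv_nonzero:
  assumes K: "K \<noteq> {}" and x: "solves S x" "x 1 = x 0" and x0: "x 0 \<in> L" "x 0 \<in> E"
  shows "\<exists>d. d \<noteq> 0 \<and> (return_deriv has_real_derivative d) (at (x 0))"
proof -
  define k where "k = x 0"
  define w where "w = poly (pderiv W) k"
  define w2 where "w2 = poly (pderiv (pderiv W)) k"
  note root = at_periodic_root[OF x x0(1), folded k_def]
  have w: "w \<noteq> 0" using pderiv_W x0(1) by (simp add: w_def k_def)
  have Fc: "continuous_on {0..1} (F k)" and F_dxc: "continuous_on {0..1} (F_dx k)"
    using F_continuous[of "\<lambda>_. k"] root(1) by auto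
  define A where "A t = integral {0..t} (F k)" for t
  have A: "(A has_real_derivative F k t) (at t within {0..1})" if "t \<in> {0..1}" for t
    unfolding A_def by (rule integral_has_real_derivative[OF Fc that])
  have Ac: "continuous_on {0..1} A" using A by (rule DERIV_continuous_on)
  have "integral {0..1} (\<lambda>t. F (x t) t) = integral {0..1} (F k)"
    by (intro integral_cong) (simp add: root(2))
  then have A1: "A 1 = 0" using x0(2) by (simp add: E_iff[OF x] A_def)
  \<comment> \<open>The integrand is the derivative of \<open>exp (w * A t) / w\<close>, and
    \<open>A\<close> vanishes at both ends because \<open>x 0 \<in> E\<close>.\<close>
  have "((\<lambda>t. F k t * exp (w * A t)) has_integral
      exp (w * A 1) / w - exp (w * A 0) / w) {0..1}"
    by (rule fundamental_theorem_of_calculus)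
      (use A w in \<open>auto intro!: derivative_eq_intros simp: mult_ac
        simp flip: has_real_derivative_iff_has_vector_derivative\<close>)
  then have FE: "((\<lambda>t. F k t * exp (w * A t)) has_integral 0) {0..1}"
    using A1 by (simp add: A_def)
  let ?D = "\<lambda>t. F_dx k t * exp (w * A t)"
  have "0 < sg * integral {0..1} (\<lambda>t. \<Sum>j\<in>K. q j t * (exp (w * A t) / (k - j)\<^sup>2))"
  proof (rule K_integral_pos[OF K])
    fix j assume "j \<in> K"
    then have j: "k \<noteq> j" using root(1) by auto
    then show "continuous_on {0..1} (\<lambda>t. exp (w * A t) / (k - j)\<^sup>2)"
      using Ac by (auto intro!: continuous_intros)
    show "0 < exp (w * A t) / (k - j)\<^sup>2" for t
      using j by (intro divide_pos_pos) auto
  qed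
  also have "(\<lambda>t. \<Sum>j\<in>K. q j t * (exp (w * A t) / (k - j)\<^sup>2)) = (\<lambda>t. - ?D t)"
    by (intro ext) (simp add: F_dx_def sum_distrib_right)
  finally have D: "integral {0..1} ?D \<noteq> 0" by auto
  have E: "integral {0..t} (\<lambda>s. S_dx (x s) s) = w * A t" if "t \<in> {0..1}" for t
  proof -
    have "integral {0..t} (\<lambda>s. S_dx (x s) s) = integral {0..t} (\<lambda>s. w * F k s)"
    proof (rule integral_cong)
      fix s assume "s \<in> {0..t}"
      then have "s \<in> {0..1}" using that by auto
      from root(3)[OF this] show "S_dx (x s) s = w * F k s" by (simp add: w_def)
    qed
    then show ?thesis by (simp add: A_def)
  qed
  have "integral {0..1} (\<lambda>t. S_dxx (x t) t * exp (integral {0..t} (\<lambda>s. S_dx (x s) s)))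
      = integral {0..1} (\<lambda>t. w2 * (F k t * exp (w * A t)) + 2 * w * ?D t)"
    by (intro integral_cong)
      (simp add: E root(2) S_dxx_at_root[OF _ root(1)] w_def w2_def algebra_simps)
  also have "\<dots> = 2 * w * integral {0..1} ?D"
    using integral_unique[OF FE] Fc F_dxc Ac
    by (subst integral_add) (auto intro!: integrable_continuous_real continuous_intros)
  finally have "integral {0..1} (\<lambda>t. S_dxx (x t) t * exp (integral {0..t} (\<lambda>s. S_dx (x s) s))) \<noteq> 0"
    using D w by simp
  moreover have "return_deriv (x 0) \<noteq> 0" by (simp add: return_deriv_def)
  ultimately show ?thesis using DERIV_return_deriv[OF x(1)] by (intro exI conjI) auto
qed

text \<open>Without poles the equation \<open>y' = p(t) W(y)\<close> separates. The integral of
  \<open>dy / W\<close> between the end values equals that of \<open>p\<close>, which is 0; since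
  \<open>W\<close> keeps its sign between them, they coincide.\<close>

lemma degenerate_all_periodic:
  assumes K: "K = {}" and p: "integral {0..1} p = 0" and x: "solves S x"
  shows "x 1 = x 0"
proof (cases "x 0 \<in> L")
  case True
  have "solves S (\<lambda>_. x 0)"
    unfolding solves_def using True K poly_W_eq_0_iff[of "x 0"] by (auto simp: S_factor)
  then show ?thesis using solution_unique[OF x, of "\<lambda>_. x 0" 1] by simp
next
  case False
  have xL: "x t \<notin> L" if t: "t \<in> {0..1}" for t
  proof
    assume k: "x t \<in> L"
    \<comment> \<open>Roots are constant solutions here, and a solution meeting one of them already
      starts there.\<close>
    have "solves S (\<lambda>_. x t)"
      unfolding solves_def using k K poly_W_eq_0_iff[of "x t"] by (auto simp: S_factor)
    from solution_diff[OF x this t] have "x 0 = x t" by simp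
    then show False using k False by simp
  qed
  let ?g = "\<lambda>y. 1 / poly W y"
  have "((\<lambda>t. F (x t) t) has_integral (integral {x 0..x 1} ?g - integral {x 1..x 0} ?g)) {0..1}"
    by (rule integral_F[OF x xL])
  then have 0: "integral {x 0..x 1} ?g = integral {x 1..x 0} ?g"
    using p by (auto dest!: integral_unique simp: K_empty_integral_F[OF K])
  have ne: "integral {u..v} ?g \<noteq> 0" if uv: "u < v" "{u..v} \<subseteq> x ` {0..1}" for u v
  proof -
    have W: "poly W y \<noteq> 0" if "y \<in> {u..v}" for y
      using xL uv that by (auto simp: poly_W_eq_0_iff subset_iff)
    have side: "poly W y < 0 \<longleftrightarrow> poly W u < 0" if y: "y \<in> {u..v}" for y
    proof -
      have "connected (poly W ` {u..v})" by (intro connected_continuous_image continuous_intros) simp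
      moreover have "0 \<notin> poly W ` {u..v}" using W by (metis imageE)
      moreover have "poly W y \<in> poly W ` {u..v}" "poly W u \<in> poly W ` {u..v}" using y uv by auto
      ultimately show ?thesis
        using connectedD_interval[of "poly W ` {u..v}" "poly W y" "poly W u" 0]
          connectedD_interval[of "poly W ` {u..v}" "poly W u" "poly W y" 0] W[OF y] W[of u] uv
        by (metis atLeastAtMost_iff linorder_le_cases linorder_not_less order.order_iff_strict)
    qed
    define s where "s = sgn (poly W u)"
    have s: "s \<noteq> 0" using W[of u] uv by (simp add: s_def sgn_if)
    have "integral {u..v} (\<lambda>y. s * ?g y) \<noteq> 0"
    proof (subst integral_eq_0_iff)
      show "continuous_on {u..v} (\<lambda>y. s * ?g y)" using W by (auto intro!: continuous_intros)
      show "s * ?g y \<ge> 0" if "y \<in> {u..v}" for y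
        using side[OF that] by (auto simp: s_def sgn_if)
      show "\<not> (\<forall>y\<in>{u..v}. s * ?g y = 0)" using uv s W[of u] by auto
    qed (use uv in auto)
    then show ?thesis by (metis integral_mult_right mult_zero_right)
  qed
  have im: "connected (x ` {0..1})" "x 0 \<in> x ` {0..1}" "x 1 \<in> x ` {0..1}"
    using solves_continuous[OF x] by (auto intro!: connected_continuous_image)
  show ?thesis
    using ne[of "x 0" "x 1"] ne[of "x 1" "x 0"] 0 connected_contains_Icc[OF im(1)] im(2,3)
    by (cases "x 0" "x 1" rule: linorder_cases) auto
qed

text \<open>Without poles \<open>F\<close> is \<open>p\<close>, so \<open>E\<close> is empty as soon
  as \<open>p\<close> has a nonzero integral.\<close>

lemma nondegenerate_E:
  assumes "K \<noteq> {} \<or> integral {0..1} p \<noteq> 0"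
  shows "finite E" "card E \<le> card K"
proof -
  have "E = {}" if "K = {}" using assms that by (auto simp: E_def K_empty_integral_F)
  then show "finite E" "card E \<le> card K" using E_card by (cases "K = {}"; auto)+
qed

end

section \<open>Orders of zeros and transfer to the original equation\<close>

lemma zero_order_le: "(deriv ^^ k) f x \<noteq> 0 \<Longrightarrow> zero_order f x \<le> enat k"
  unfolding zero_order_def by (rule INF_lower) simp

lemma zero_order_le_1:
  "(f has_real_derivative d) (at x) \<Longrightarrow> d \<noteq> 0 \<Longrightarrow> zero_order f x \<le> enat 1"
  by (rule zero_order_le) (simp add: DERIV_imp_deriv)

text \<open>The first derivative has to be known on a neighbourhood, since \<open>deriv f\<close>
  itself is differentiated.\<close>

lemma zero_order_le_2:
  assumes "open U" "x \<in> U" "\<And>y. y \<in> U \<Longrightarrow> (f has_real_derivative f' y) (at y)"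
    and f': "(f' has_real_derivative d) (at x)" and d: "d \<noteq> 0"
  shows "zero_order f x \<le> enat 2"
proof (rule zero_order_le)
  have "(deriv f has_real_derivative d) (at x)"
    using f' assms(1,2) by (rule has_field_derivative_transform_within_open)
      (simp add: DERIV_imp_deriv[OF assms(3)])
  then show "(deriv ^^ 2) f x \<noteq> 0" using d by (simp add: numeral_2_eq_2 DERIV_imp_deriv)
qed

lemma zero_order_ge_1: "f x = 0 \<Longrightarrow> zero_order f x \<ge> enat 1"
  unfolding zero_order_def
proof (rule INF_greatest)
  fix k assume "f x = 0" "k \<in> {k. (deriv ^^ k) f x \<noteq> 0}"
  then show "enat 1 \<le> enat k" by (cases k) auto
qed

section \<open>Transport of periodic solutions and multiplicities along the substitution\<close>

context polynomial_equation
begin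

lemma periodic_inits_iff: "x0 \<in> periodic_inits S \<longleftrightarrow> (\<exists>x. solves S x \<and> x 0 = x0 \<and> x 1 = x0)"
proof
  assume "x0 \<in> periodic_inits S"
  then obtain x where "solves S x" "x 0 = x0" "return_map S x0 = x0"
    by (auto simp: periodic_inits_def return_dom_def)
  then show "\<exists>x. solves S x \<and> x 0 = x0 \<and> x 1 = x0"
    using return_map_eq[of x] by auto
next
  assume "\<exists>x. solves S x \<and> x 0 = x0 \<and> x 1 = x0"
  then obtain x where x: "solves S x" "x 0 = x0" "x 1 = x0" by blast
  then show "x0 \<in> periodic_inits S"
    using return_map_eq[OF x(1)] return_domI[OF x(1)] by (simp add: periodic_inits_def)
qed

end

text \<open>\<open>T\<close> is the original right-hand side and \<open>S\<close> the transformed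
  one. The original equation enters only through the correspondence of solutions under
  \<open>x = a y + b\<close>.\<close>

locale conjugate_equation = alternating_equation +
  fixes T :: "real \<Rightarrow> real \<Rightarrow> real" and a b :: "real \<Rightarrow> real"
  assumes to_T: "solves (poly_rhs m c) y \<Longrightarrow> solves T (\<lambda>t. a t * y t + b t)"
    and from_T: "solves T x \<Longrightarrow> solves (poly_rhs m c) (\<lambda>t. (x t - b t) / a t)"
    and ends: "a 0 = a 1" "b 0 = b 1" "a 0 \<noteq> 0"
begin

definition A :: "real \<Rightarrow> real" where "A y = a 0 * y + b 0"

definition A_inv :: "real \<Rightarrow> real" where "A_inv x = (x - b 0) / a 0"

lemma A_inv [simp]: "A (A_inv x) = x" "A_inv (A y) = y"
  using ends by (auto simp: A_def A_inv_def)

lemma return_map_T: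
  assumes "y0 \<in> return_dom S"
  shows "return_map T (A y0) = A (return_map S y0)"
  unfolding return_map_def[of T]
proof (rule the_equality)
  obtain y where y: "solves S y" "y 0 = y0" using assms by (auto simp: return_dom_def)
  have "return_map S y0 = y 1" using return_map_eq[OF y(1)] y(2) by simp
  then show "\<exists>x. solves T x \<and> x 0 = A y0 \<and> x 1 = A (return_map S y0)"
    using to_T[OF y(1)] y ends by (intro exI[of _ "\<lambda>t. a t * y t + b t"]) (simp add: A_def)
next
  \<comment> \<open>Uniqueness for \<open>T\<close> is pulled back to \<open>S\<close>.\<close>
  fix x1 assume "\<exists>x. solves T x \<and> x 0 = A y0 \<and> x 1 = x1"
  then obtain x where x: "solves T x" "x 0 = A y0" "x 1 = x1" by blast
  have "return_map S (A_inv (x 0)) = A_inv (x 1)"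
    using return_map_eq[OF from_T[OF x(1)]] ends by (simp add: A_inv_def)
  then have "return_map S y0 = A_inv x1" using x by simp
  then show "x1 = A (return_map S y0)" by simp
qed

lemma return_dom_T: "x0 \<in> return_dom T \<longleftrightarrow> A_inv x0 \<in> return_dom S"
proof
  assume "x0 \<in> return_dom T"
  then obtain x where x: "solves T x" "x 0 = x0" by (auto simp: return_dom_def)
  show "A_inv x0 \<in> return_dom S"
    using return_domI[OF from_T[OF x(1)]] x(2) by (simp add: A_inv_def)
next
  assume "A_inv x0 \<in> return_dom S"
  then obtain y where y: "solves S y" "y 0 = A_inv x0" by (auto simp: return_dom_def)
  then have "a 0 * y 0 + b 0 = x0" using A_inv(1)[of x0] by (simp add: A_def)
  then show "x0 \<in> return_dom T"
    unfolding return_dom_def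
    by (intro CollectI exI[of _ "\<lambda>t. a t * y t + b t"] conjI to_T[OF y(1)])
qed

lemma A_eq_iff: "A y = A z \<longleftrightarrow> y = z"
  using ends by (simp add: A_def)

lemma periodic_inits_T: "x0 \<in> periodic_inits T \<longleftrightarrow> A_inv x0 \<in> periodic_inits S"
proof (cases "A_inv x0 \<in> return_dom S")
  case True
  have "return_map T x0 = x0 \<longleftrightarrow> return_map S (A_inv x0) = A_inv x0"
    using return_map_T[OF True] A_eq_iff[of "return_map S (A_inv x0)" "A_inv x0"] by simp
  then show ?thesis using True return_dom_T unfolding periodic_inits_def by blast
next
  case False
  then show ?thesis using return_dom_T unfolding periodic_inits_def by blast
qed

lemma open_return_dom_T: "open (return_dom T)"
proof -
  have "return_dom T = A_inv -` return_dom S" by (auto simp: return_dom_T)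
  moreover have "continuous_on UNIV A_inv" unfolding A_inv_def using ends by (intro continuous_intros) auto
  ultimately show ?thesis using open_return_dom by (simp add: open_vimage)
qed

text \<open>The slopes \<open>a 0\<close> and \<open>1 / a 0\<close> of the affine conjugation
  cancel in the chain rule.\<close>

lemma DERIV_displacement_T:
  assumes x0: "x0 \<in> return_dom T"
  shows "((\<lambda>x. return_map T x - x) has_real_derivative return_deriv (A_inv x0) - 1) (at x0)"
proof -
  have inv: "(A_inv has_real_derivative 1 / a 0) (at x0)"
    unfolding A_inv_def[abs_def] using ends by (auto intro!: derivative_eq_intros)
  have "((\<lambda>x. return_map S (A_inv x)) has_real_derivative return_deriv (A_inv x0) * (1 / a 0)) (at x0)"
    using DERIV_chain2[OF DERIV_return_map inv] x0 by (simp add: return_dom_T)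
  then have "((\<lambda>x. A (return_map S (A_inv x)) - x) has_real_derivative return_deriv (A_inv x0) - 1) (at x0)"
    unfolding A_def using ends by (auto intro!: derivative_eq_intros)
  then show ?thesis
    by (rule has_field_derivative_transform_within_open[OF _ open_return_dom_T x0])
      (use return_map_T[of "A_inv x" for x] in \<open>simp add: return_dom_T\<close>)
qed

text \<open>Weight 2 on the overlap of \<open>L - K\<close> and \<open>E\<close>, so that the total
  weight is \<open>card (L - K) + card E\<close>.\<close>

definition mult_bound :: "real \<Rightarrow> nat" where
  "mult_bound y = of_bool (y \<in> L - K) + of_bool (y \<in> E)"

text \<open>Solutions off \<open>L\<close> and roots outside \<open>E\<close> are simple by the
  first derivative; a root in \<open>E\<close> is at most double by the second.\<close>

lemma periodic_mult_T:
  assumes nd: "K \<noteq> {} \<or> integral {0..1} p \<noteq> 0" and x0: "x0 \<in> periodic_inits T"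
  shows "periodic_mult T x0 \<le> enat (mult_bound (A_inv x0))"
proof -
  obtain y where y: "solves S y" "y 0 = A_inv x0" "y 1 = y 0"
    using x0 unfolding periodic_inits_T periodic_inits_iff by auto
  have x0T: "x0 \<in> return_dom T" using x0 by (simp add: periodic_inits_def)
  have K: "K \<noteq> {}" if "y 0 \<in> E"
    using nondegenerate_E[OF nd] that by (auto simp: card_eq_0_iff)
  have ord1: "periodic_mult T x0 \<le> enat 1" if "return_deriv (y 0) \<noteq> 1"
    unfolding periodic_mult_def
    by (rule zero_order_le_1[OF DERIV_displacement_T[OF x0T]]) (use that y in simp)
  consider "y 0 \<notin> L" | "y 0 \<in> L" "y 0 \<notin> E" | "y 0 \<in> L" "y 0 \<in> E" by blast
  then show ?thesis
  proof cases
    case 1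
    then have "y 0 \<in> E" using periodic_init[OF y(1,3)] by auto
    then show ?thesis
      using ord1[OF return_deriv_ne_1_off_L[OF K y(1,3) 1]] 1 y(2) by (simp add: mult_bound_def)
  next
    case 2
    then have "y 0 \<in> L - K" using periodic_init[OF y(1,3)] by auto
    then show ?thesis
      using ord1[OF return_deriv_ne_1_on_L[OF y(1,3) 2]] 2 y(2) by (simp add: mult_bound_def)
  next
    case 3
    obtain d where d: "d \<noteq> 0" "(return_deriv has_real_derivative d) (at (A_inv x0))"
      using DERIV_return_deriv_nonzero[OF K[OF 3(2)] y(1,3) 3] y(2) by auto
    have "(A_inv has_real_derivative 1 / a 0) (at x0)"
      unfolding A_inv_def[abs_def] using ends by (auto intro!: derivative_eq_intros)
    from DERIV_chain2[OF d(2) this]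
    have "((\<lambda>x. return_deriv (A_inv x) - 1) has_real_derivative d * (1 / a 0)) (at x0)"
      by (auto intro!: derivative_eq_intros)
    from zero_order_le_2[OF open_return_dom_T x0T DERIV_displacement_T this]
    have "periodic_mult T x0 \<le> enat 2"
      using d ends by (simp add: periodic_mult_def)
    moreover have "y 0 \<in> L - K" using at_periodic_root(1)[OF y(1,3) 3(1)] .
    ultimately show ?thesis using 3 y(2) by (simp add: mult_bound_def numeral_2_eq_2)
  qed
qed

lemma count_nonzero_isolated_T: "count_nonzero_isolated T \<le> enat (card L)"
proof (cases "K = {} \<and> integral {0..1} p = 0")
  case True
  then have "return_dom S \<subseteq> periodic_inits S"
    unfolding return_dom_def subset_iff mem_Collect_eq periodic_inits_iff
    using degenerate_all_periodic by metis
  then have "return_dom T = periodic_inits T"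
    using return_dom_T periodic_inits_T unfolding periodic_inits_def[of T] by blast
  \<comment> \<open>All solutions are periodic, so the periodic initial values fill an open set, and
    no point of an open set of reals is isolated in it.\<close>
  then have "open (periodic_inits T)" using open_return_dom_T by simp
  then have "\<not> x0 isolated_in periodic_inits T" for x0
    unfolding isolated_in_def by (metis open_Int not_open_singleton)
  then have "nonzero_isolated_inits T = {}"
    by (simp add: nonzero_isolated_inits_def)
  then show ?thesis by (simp add: count_nonzero_isolated_def zero_enat_def)
next
  case False
  then have nd: "K \<noteq> {} \<or> integral {0..1} p \<noteq> 0" by blast
  let ?N = "nonzero_isolated_inits T" and ?B = "(L - K) \<union> E"
  have per: "?N \<subseteq> periodic_inits T"
    by (auto simp: nonzero_isolated_inits_def isolated_in_def)
  have B: "A_inv ` ?N \<subseteq> ?B"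
  proof (rule image_subsetI)
    fix x0 assume "x0 \<in> ?N"
    then have "A_inv x0 \<in> periodic_inits S" using per periodic_inits_T by blast
    then obtain y where "solves S y" "y 0 = A_inv x0" "y 1 = A_inv x0"
      unfolding periodic_inits_iff by blast
    then show "A_inv x0 \<in> ?B" using periodic_init[of y] by simp
  qed
  have fin: "finite ?B" using finite_L nondegenerate_E[OF nd] by auto
  have inj: "inj_on A_inv ?N" by (metis A_inv(1) inj_on_def)
  have finN: "finite ?N" using finite_imageD[OF finite_subset[OF B fin] inj] .
  have "(\<Sum>x0\<in>?N. periodic_mult T x0) \<le> (\<Sum>x0\<in>?N. enat (mult_bound (A_inv x0)))"
    using per by (intro sum_mono periodic_mult_T[OF nd]) auto
  also have "\<dots> = enat (\<Sum>x0\<in>?N. mult_bound (A_inv x0))"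
    by (simp flip: of_nat_eq_enat)
  also have "\<dots> \<le> enat (card L)"
  proof -
    have sum_of_bool: "(\<Sum>y\<in>?B. of_bool (y \<in> X)) = card (?B \<inter> X)" for X
      using fin by simp
    have "(\<Sum>x0\<in>?N. mult_bound (A_inv x0)) = (\<Sum>y\<in>A_inv ` ?N. mult_bound y)"
      by (simp add: sum.reindex[OF inj])
    also have "\<dots> \<le> (\<Sum>y\<in>?B. mult_bound y)"
      by (rule sum_mono2[OF fin B]) simp
    also have "\<dots> = card (?B \<inter> (L - K)) + card (?B \<inter> E)"
      by (simp only: mult_bound_def sum.distrib sum_of_bool)
    also have "\<dots> = card (L - K) + card E"
      by (intro arg_cong2[where f = "(+)"] arg_cong[where f = card]) auto
    also have "\<dots> \<le> card (L - K) + card K" using nondegenerate_E(2)[OF nd] by simp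
    also have "\<dots> = card L"
      using finite_L K_subset by (simp add: card_Diff_subset finite_K card_mono)
    finally show ?thesis by simp
  qed
  finally show ?thesis using finN by (simp add: count_nonzero_isolated_def)
qed

end

section \<open>From admissible data to the interpolated equation\<close>

lemma smooth_unitE:
  assumes "smooth_unit f"
  obtains f' where "continuous_on {0..1} f" "continuous_on {0..1} f'"
    "\<And>t. t \<in> {0..1} \<Longrightarrow> (f has_real_derivative f' t) (at t within {0..1})"
proof -
  obtain D where D: "\<And>t. t \<in> {0..1} \<Longrightarrow> D 0 t = f t"
    "\<And>k t. t \<in> {0..1} \<Longrightarrow> (D k has_real_derivative D (Suc k) t) (at t within {0..1})"
    using assms unfolding smooth_unit_def by blast
  have 1: "(f has_real_derivative D 1 t) (at t within {0..1})" if t: "t \<in> {0..1}" for t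
    by (rule has_field_derivative_transform_within[OF D(2)[OF t, of 0, folded One_nat_def] zero_less_one t])
      (simp add: D(1))
  show ?thesis
  proof (rule that[of "D 1"])
    show "continuous_on {0..1} f" using 1 by (rule DERIV_continuous_on)
    show "continuous_on {0..1} (D 1)" using D(2) by (rule DERIV_continuous_on)
  qed (rule 1)
qed

lemma smooth_unit_const: "smooth_unit (\<lambda>_. r)"
  unfolding smooth_unit_def
proof (intro exI[of _ "\<lambda>k _. if k = 0 then r else 0"] conjI allI ballI)
  fix k :: nat and t :: real
  show "((\<lambda>_. if k = 0 then r else 0) has_real_derivative (if Suc k = 0 then r else 0)) (at t within {0..1})"
    by simp
qed simp

lemma poly_eq_sum_le:
  assumes "degree P \<le> m"
  shows "(\<Sum>i\<le>m. coeff P i * x ^ i) = poly P (x :: 'a :: comm_ring_1)"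
  unfolding poly_altdef using assms
  by (intro sum.mono_neutral_right) (auto simp: coeff_eq_0)

lemma degree_root_poly_le:
  fixes A :: "real set"
  assumes "finite A"
  shows "degree (\<Prod>k\<in>A. [:- k, 1:]) \<le> card A"
  using degree_prod_sum_le[OF assms, of "\<lambda>k. [:- k, 1:]"] by simp

text \<open>Lagrange interpolation at the points of \<open>L\<close>, one degree too low; the leading coefficient
  is read off at a further point \<open>z\<close>.\<close>

lemma lagrange_form:
  fixes P :: "real poly"
  assumes L: "finite L" and deg: "degree P \<le> card L" and z: "z \<notin> L"
  defines "q \<equiv> \<lambda>k. poly P k / (\<Prod>j\<in>L - {k}. k - j)"
  defines "p \<equiv> (poly P z - (\<Sum>k\<in>L. q k * (\<Prod>j\<in>L - {k}. z - j))) / (\<Prod>k\<in>L. z - k)"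
  shows "P = smult p (\<Prod>k\<in>L. [:- k, 1:]) + (\<Sum>k\<in>L. smult (q k) (\<Prod>j\<in>L - {k}. [:- j, 1:]))"
    (is "P = ?Q")
proof (rule poly_eqI_degree)
  \<comment> \<open>Both sides have degree at most \<open>card L\<close> and are compared at
    \<open>card L + 1\<close> points.\<close>
  have c: "card (insert z L) = Suc (card L)" using L z by simp
  show "degree P < card (insert z L)" using deg c by simp
  have "degree (smult (q k) (\<Prod>j\<in>L - {k}. [:- j, 1:])) \<le> card L" for k
    using degree_smult_le[of "q k" "\<Prod>j\<in>L - {k}. [:- j, 1:]"] degree_root_poly_le[of "L - {k}"] L
      card_mono[OF L, of "L - {k}"] by force
  moreover have "degree (smult p (\<Prod>k\<in>L. [:- k, 1:])) \<le> card L"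
    by (rule order_trans[OF degree_smult_le degree_root_poly_le[OF L]])
  ultimately have "degree ?Q \<le> card L"
    using L by (intro degree_add_le degree_sum_le)
  then show "degree ?Q < card (insert z L)" using c by simp
  have Q: "poly ?Q x = p * (\<Prod>k\<in>L. x - k) + (\<Sum>k\<in>L. q k * (\<Prod>j\<in>L - {k}. x - j))" for x
    by (simp add: poly_sum poly_prod)
  fix x assume "x \<in> insert z L"
  then consider "x = z" | "x \<in> L" by auto
  then show "poly P x = poly ?Q x"
  proof cases
    case 1
    have "(\<Prod>k\<in>L. z - k) \<noteq> 0" using L z by auto
    then show ?thesis unfolding Q 1 by (simp add: p_def)
  next
    case 2
    have "(\<Sum>k\<in>L. q k * (\<Prod>j\<in>L - {k}. x - j)) = (\<Sum>k\<in>L. if k = x then poly P x else 0)"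
    proof (rule sum.cong)
      fix k assume "k \<in> L"
      show "q k * (\<Prod>j\<in>L - {k}. x - j) = (if k = x then poly P x else 0)"
        using L 2 by (auto simp: q_def)
    qed simp
    moreover have "(\<Prod>k\<in>L. x - k) = 0" using L 2 by auto
    ultimately show ?thesis using L 2 unfolding Q by simp
  qed
qed

text \<open>Exactly the \<open>m - i\<close> factors with \<open>j > i\<close> are negative.\<close>

lemma root_product_sign:
  fixes l :: "nat \<Rightarrow> real"
  assumes l: "strict_mono_on {1..m} l" and i: "i \<in> {1..m}"
  shows "(-1) ^ (m - i) * (\<Prod>j\<in>{1..m} - {i}. l i - l j) > 0"
proof -
  have split: "{1..m} - {i} = {1..<i} \<union> {i<..m}" using i by auto
  have "(\<Prod>j\<in>{1..m} - {i}. l i - l j) = (\<Prod>j\<in>{1..<i}. l i - l j) * (\<Prod>j\<in>{i<..m}. l i - l j)"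
    unfolding split by (rule prod.union_disjoint) auto
  also have "(\<Prod>j\<in>{i<..m}. l i - l j) = (\<Prod>j\<in>{i<..m}. (-1) * (l j - l i))" by simp
  also have "\<dots> = (-1) ^ (m - i) * (\<Prod>j\<in>{i<..m}. l j - l i)"
    by (simp only: prod.distrib prod_constant card_greaterThanAtMost)
  finally have "(-1) ^ (m - i) * (\<Prod>j\<in>{1..m} - {i}. l i - l j)
      = ((-1) ^ (m - i) * (-1) ^ (m - i)) * ((\<Prod>j\<in>{1..<i}. l i - l j) * (\<Prod>j\<in>{i<..m}. l j - l i))"
    by (simp only: mult_ac)
  also have "(-1) ^ (m - i) * (-1) ^ (m - i) = (1 :: real)"
    by (simp flip: power_mult_distrib)
  also have "1 * ((\<Prod>j\<in>{1..<i}. l i - l j) * (\<Prod>j\<in>{i<..m}. l j - l i)) > 0"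
    using i by (auto intro!: mult_pos_pos prod_pos strict_mono_onD[OF l])
  finally show ?thesis .
qed

text \<open>The determinant on the i-th curve is \<open>a t\<close> times the transformed right-hand
  side at \<open>l i\<close>. Its sign alternates in \<open>i\<close>, and so does that of the root
  product by which interpolation divides; hence all \<open>q k\<close> share one sign.\<close>

lemma admissible_conjugate_equation:
  assumes adm: "admissible m c a b l" and m: "m \<ge> 1"
  obtains d q p sg where "conjugate_equation m d (l ` {1..m}) q p sg (poly_rhs m c) a b"
proof -
  have sm: "\<And>i. i \<le> m \<Longrightarrow> smooth_unit (c i)" "smooth_unit a" "smooth_unit b"
    and ends: "a 0 = a 1" "b 0 = b 1" and a_pos: "\<And>t. t \<in> {0..1} \<Longrightarrow> a t > 0"
    and l: "strict_mono_on {1..m} l"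
    using adm by (auto simp: admissible_def)
  obtain a' where a': "continuous_on {0..1} a" "continuous_on {0..1} a'"
    "\<And>t. t \<in> {0..1} \<Longrightarrow> (a has_real_derivative a' t) (at t within {0..1})"
    using smooth_unitE[OF sm(2)] by blast
  obtain b' where b': "continuous_on {0..1} b" "continuous_on {0..1} b'"
    "\<And>t. t \<in> {0..1} \<Longrightarrow> (b has_real_derivative b' t) (at t within {0..1})"
    using smooth_unitE[OF sm(3)] by blast
  have c: "continuous_on {0..1} (c i)" if "i \<le> m" for i
    using smooth_unitE[OF sm(1)[OF that]] by blast
  define L where "L = l ` {1..m}"
  have inj: "inj_on l {1..m}" using l by (rule strict_mono_on_imp_inj_on)
  have L: "finite L" "card L = m" using card_image[OF inj] by (simp_all add: L_def)
  obtain z where z: "z \<notin> L" using ex_new_if_finite[OF infinite_UNIV_char_0 L(1)] by blast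
  \<comment> \<open>The transformed right-hand side at time \<open>t\<close> as a polynomial in
    \<open>y\<close>; \<open>[:b t, a t:]\<close> is the substitution.\<close>
  define P where "P t = smult (1 / a t)
    ((\<Sum>i\<le>m. smult (c i t) ([:b t, a t:] ^ i)) - [:b' t, a' t:])" for t
  have P: "poly (P t) y = (poly_rhs m c (a t * y + b t) t - a' t * y - b' t) / a t" for t y
    by (simp add: P_def poly_sum poly_power poly_rhs_def add.commute mult.commute)
  have "degree (P t) \<le> m" for t
  proof -
    have "degree ([:b t, a t:] ^ i) \<le> i" for i
      using degree_power_le[of "[:b t, a t:]" i] by (auto split: if_splits)
    then have "degree (\<Sum>i\<le>m. smult (c i t) ([:b t, a t:] ^ i)) \<le> m"
      by (intro degree_sum_le order_trans[OF degree_smult_le]) (auto intro: order_trans)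
    \<comment> \<open>Here \<open>m \<ge> 1\<close> enters: the moving frame contributes a term
      linear in \<open>y\<close>.\<close>
    moreover have "degree [:b' t, a' t:] \<le> m" using m by simp
    ultimately show ?thesis
      unfolding P_def by (intro order_trans[OF degree_smult_le] degree_diff_le)
  qed
  then have deg: "degree (P t) \<le> card L" for t using L by simp
  define q where "q k t = poly (P t) k / (\<Prod>j\<in>L - {k}. k - j)" for k t
  define p where "p t = (poly (P t) z - (\<Sum>k\<in>L. q k t * (\<Prod>j\<in>L - {k}. z - j))) / (\<Prod>k\<in>L. z - k)" for t
  have P_eq: "P t = smult (p t) (\<Prod>k\<in>L. [:- k, 1:]) + (\<Sum>k\<in>L. smult (q k t) (\<Prod>j\<in>L - {k}. [:- j, 1:]))" for t
    unfolding p_def q_def by (rule lagrange_form[OF L(1) deg z])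
  define d where "d i t = coeff (P t) i" for i t
  have d: "poly_rhs m d y t = poly (P t) y" for y t
    unfolding poly_rhs_def d_def using deg L by (intro poly_eq_sum_le) simp
  have Pc: "continuous_on {0..1} (\<lambda>t. poly (P t) y)" for y
    unfolding P poly_rhs_def using a_pos
    by (intro continuous_intros c a' b') (auto simp: less_imp_neq[symmetric])
  have qc: "continuous_on {0..1} (q k)" if "k \<in> L" for k
    unfolding q_def using L that by (intro continuous_intros Pc) auto
  have pc: "continuous_on {0..1} p"
    unfolding p_def using L z by (intro continuous_intros Pc qc) auto
  \<comment> \<open>\<open>e\<close> is 1 or -1 and merges the two sign alternatives.\<close>
  obtain e :: real where e: "e \<noteq> 0"
    "\<And>i t. i \<in> {1..m} \<Longrightarrow> t \<in> {0..1} \<Longrightarrow> e * ((-1) ^ i * det_along (poly_rhs m c) (curve a b (l i)) t) \<ge> 0"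
  proof (cases "\<forall>i\<in>{1..m}. \<forall>t\<in>{0..1}. (-1) ^ i * det_along (poly_rhs m c) (curve a b (l i)) t \<ge> 0")
    case True
    then show ?thesis by (intro that[of 1]) auto
  next
    case False
    then have "\<forall>i\<in>{1..m}. \<forall>t\<in>{0..1}. (-1) ^ i * det_along (poly_rhs m c) (curve a b (l i)) t \<le> 0"
      using adm unfolding admissible_def by blast
    then show ?thesis by (intro that[of "-1"]) auto
  qed
  have "conjugate_equation m d L q p (e * (-1) ^ m) (poly_rhs m c) a b"
  proof unfold_locales
    show "continuous_on {0..1} (d i)" if "i \<le> m" for i
      unfolding d_def P_eq by (simp add: coeff_sum) (intro continuous_intros pc qc)
    show "e * (-1) ^ m * q k t \<ge> 0" if k: "k \<in> L" and t: "t \<in> {0..1}" for k t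
    proof -
      obtain i where i: "i \<in> {1..m}" "k = l i" using k by (auto simp: L_def)
      define W where "W = (\<Prod>j\<in>{1..m} - {i}. l i - l j)"
      have "L - {k} = l ` ({1..m} - {i})" 
        using inj_on_image_set_diff[OF inj, of "{1..m}" "{i}"] i by (simp add: L_def)
      then have W: "(\<Prod>j\<in>L - {k}. k - j) = W"
        unfolding W_def i(2) using inj by (simp add: prod.reindex inj_on_diff)
      define X where "X = det_along (poly_rhs m c) (curve a b (l i)) t"
      have X: "poly (P t) k = X / a t"
        unfolding P X_def i(2) det_along_curve[OF a'(3)[OF t] b'(3)[OF t] t] by (simp add: mult.commute)
      have sgn: "(-1) ^ (m - i) * W > 0" unfolding W_def by (rule root_product_sign[OF l i(1)])
      \<comment> \<open>The sign splits into \<open>(-1) ^ i\<close> for the determinant and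
        \<open>(-1) ^ (m - i)\<close> for the root product; the latter is its own inverse and moves
        into the denominator.\<close>
      have m_eq: "(-1 :: real) ^ m = (-1) ^ i * (-1) ^ (m - i)"
        using i by (simp flip: power_add)
      have "(-1) ^ (m - i) = (1 :: real) \<or> (-1) ^ (m - i) = (-1 :: real)"
        by (cases "even (m - i)") auto
      then have "e * (-1) ^ m * q k t = e * ((-1) ^ i * X) / (a t * ((-1) ^ (m - i) * W))"
        unfolding q_def W X m_eq by (elim disjE) (simp_all add: mult_ac)
      also have "\<dots> \<ge> 0"
        using e(2)[OF i(1) t] sgn a_pos[OF t] unfolding X_def by (intro divide_nonneg_pos) auto
      finally show ?thesis .
    qed
    show "e * (-1) ^ m \<noteq> 0" using e by simp
    show "poly_rhs m d y t = p t * (\<Prod>k\<in>L. y - k) + (\<Sum>k\<in>L. q k t * (\<Prod>j\<in>L - {k}. y - j))" for t y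
      unfolding d by (subst P_eq) (simp add: poly_sum poly_prod)
    show "solves (poly_rhs m c) (\<lambda>t. a t * y t + b t)" if y: "solves (poly_rhs m d) y" for y
      unfolding solves_def
    proof
      fix t :: real assume t: "t \<in> {0..1}"
      have "(y has_real_derivative poly (P t) (y t)) (at t within {0..1})"
        using y t by (simp add: solves_def d)
      from DERIV_add[OF DERIV_mult[OF a'(3)[OF t] this] b'(3)[OF t]]
      show "((\<lambda>t. a t * y t + b t) has_real_derivative poly_rhs m c (a t * y t + b t) t) (at t within {0..1})"
        by (rule DERIV_cong) (use a_pos[OF t] in \<open>simp add: P\<close>)
    qed
    show "solves (poly_rhs m d) (\<lambda>t. (x t - b t) / a t)" if x: "solves (poly_rhs m c) x" for x
      unfolding solves_def d
    proof
      fix t :: real assume t: "t \<in> {0..1}"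
      have "(x has_real_derivative poly_rhs m c (x t) t) (at t within {0..1})"
        using x t by (simp add: solves_def)
      from DERIV_divide[OF DERIV_diff[OF this b'(3)[OF t]] a'(3)[OF t]]
      show "((\<lambda>t. (x t - b t) / a t) has_real_derivative poly (P t) ((x t - b t) / a t)) (at t within {0..1})"
        by (rule DERIV_cong) (use a_pos[OF t] in \<open>simp_all add: P field_simps\<close>)
    qed
    show "a 0 \<noteq> 0" using a_pos[of 0] by auto
  qed (use L qc pc ends in auto)
  then show ?thesis unfolding L_def by (rule that)
qed

lemma count_nonzero_isolated_le:
  assumes "admissible m c a b l" "m \<ge> 1"
  shows "count_nonzero_isolated (poly_rhs m c) \<le> enat m"
proof -
  obtain d q p sg where "conjugate_equation m d (l ` {1..m}) q p sg (poly_rhs m c) a b"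
    using admissible_conjugate_equation[OF assms] .
  then have "count_nonzero_isolated (poly_rhs m c) \<le> enat (card (l ` {1..m}))"
    by (rule conjugate_equation.count_nonzero_isolated_T)
  moreover have "card (l ` {1..m}) = m"
    using assms(1) by (simp add: admissible_def card_image strict_mono_on_imp_inj_on)
  ultimately show ?thesis by simp
qed

section \<open>Sharpness: the autonomous equation with roots 1, ..., m\<close>

definition sharp_coeff :: "nat \<Rightarrow> nat \<Rightarrow> real \<Rightarrow> real" where
  "sharp_coeff m i t = coeff (\<Prod>k\<in>real ` {1..m}. [:- k, 1:]) i"

lemma poly_rhs_sharp: "poly_rhs m (sharp_coeff m) x t = (\<Prod>k\<in>real ` {1..m}. x - k)"
proof -
  have "degree (\<Prod>k\<in>real ` {1..m}. [:- k, 1:]) \<le> m"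
    using degree_root_poly_le[of "real ` {1..m}"] by (simp add: card_image)
  then show ?thesis
    unfolding poly_rhs_def sharp_coeff_def by (simp add: poly_eq_sum_le poly_prod)
qed

text \<open>The lines \<open>x = i\<close> are solutions, so all determinants vanish and satisfy the
  sign conditions.\<close>

lemma admissible_sharp: "admissible m (sharp_coeff m) (\<lambda>_. 1) (\<lambda>_. 0) real"
proof -
  have "det_along (poly_rhs m (sharp_coeff m)) (curve (\<lambda>_. 1) (\<lambda>_. 0) (real i)) t = 0"
    if i: "i \<in> {1..m}" and t: "t \<in> {0..1}" for i t
  proof -
    have "(\<Prod>k\<in>real ` {1..m}. real i - k) = 0"
      by (rule prod_zero) (use i in auto)
    then show ?thesis
      using det_along_curve[OF DERIV_const[of 1] DERIV_const[of 0] t]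
      by (simp add: poly_rhs_sharp)
  qed
  then show ?thesis
    using smooth_unit_const unfolding admissible_def sharp_coeff_def[abs_def]
    by (simp add: strict_mono_on_def)
qed

text \<open>The upper bound is the general one. For the lower bound, each of the \<open>m\<close>
  nonzero roots is an isolated periodic solution of multiplicity at least 1.\<close>

lemma count_sharp:
  assumes "m \<ge> 1"
  shows "count_nonzero_isolated (poly_rhs m (sharp_coeff m)) = enat m"
proof (rule antisym)
  let ?S = "poly_rhs m (sharp_coeff m)" and ?L = "real ` {1..m}"
  show "count_nonzero_isolated ?S \<le> enat m"
    by (rule count_nonzero_isolated_le[OF admissible_sharp assms])
  \<comment> \<open>With \<open>q = 0\<close> and \<open>p = 1\<close> there are no poles and
    \<open>E\<close> is empty, so every periodic solution starts at a root.\<close>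
  interpret alternating_equation m "sharp_coeff m" ?L "\<lambda>_ _. 0" "\<lambda>_. 1" 1
  proof unfold_locales
    show "continuous_on {0..1} (sharp_coeff m i)" for i
      by (simp add: sharp_coeff_def[abs_def])
  qed (simp_all add: poly_rhs_sharp)
  have K: "K = {}" unfolding K_def by simp
  have "E = {}" using nondegenerate_E[unfolded K] by auto
  then have per: "periodic_inits ?S \<subseteq> ?L"
    using periodic_init unfolding subset_iff periodic_inits_iff by force
  then have fin: "finite (periodic_inits ?S)" by (rule finite_subset) simp
  have sub: "?L \<subseteq> nonzero_isolated_inits ?S"
  proof
    fix k assume k: "k \<in> ?L"
    then have root: "(\<Prod>j\<in>?L. k - j) = 0" by (intro prod_zero) auto
    have s: "solves ?S (\<lambda>_. k)"
      unfolding solves_def poly_rhs_sharp root by simp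
    then have kp: "k \<in> periodic_inits ?S" unfolding periodic_inits_iff by blast
    have "open (- (periodic_inits ?S - {k}))"
      using fin by (intro open_Compl finite_imp_closed) simp
    moreover have "- (periodic_inits ?S - {k}) \<inter> periodic_inits ?S = {k}" using kp by auto
    ultimately have "k isolated_in periodic_inits ?S" using kp unfolding isolated_in_def by blast
    moreover have "k \<noteq> 0" using k by auto
    ultimately show "k \<in> nonzero_isolated_inits ?S"
      unfolding nonzero_isolated_inits_def using s by (intro CollectI conjI exI[of _ "\<lambda>_. k"]) auto
  qed
  have iso: "nonzero_isolated_inits ?S \<subseteq> periodic_inits ?S"
    by (auto simp: nonzero_isolated_inits_def isolated_in_def)
  then have eq: "nonzero_isolated_inits ?S = ?L" using sub per by blast
  have "enat 1 \<le> periodic_mult ?S x0" if "x0 \<in> ?L" for x0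
    using that iso unfolding eq periodic_mult_def periodic_inits_def
    by (intro zero_order_ge_1) auto
  then have "(\<Sum>x0\<in>?L. enat 1) \<le> (\<Sum>x0\<in>?L. periodic_mult ?S x0)"
    by (rule sum_mono)
  moreover have "(\<Sum>x0\<in>?L. enat 1) = enat m"
    by (simp add: card_image of_nat_eq_enat flip: one_enat_def)
  ultimately show "enat m \<le> count_nonzero_isolated ?S"
    by (simp add: count_nonzero_isolated_def eq)
qed

theorem theorem1p5:
  fixes m :: nat
  assumes "m \<ge> 1"
  shows "(\<forall>c a b l. admissible m c a b l \<longrightarrow>
            count_nonzero_isolated (poly_rhs m c) \<le> enat m) \<and>
         (\<exists>c a b l. admissible m c a b l \<and>
            count_nonzero_isolated (poly_rhs m c) = enat m)"
  using count_nonzero_isolated_le admissible_sharp count_sharp assms by blast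

end
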